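(* Let $N^{a,b,\mathrm{id}}$ be a network on a cylinder consisting of $n$ horizontal wires $W_1,\dots,W_n$, not crossing each other and going from the left boundary to the right boundary, crossed by $m=a+b$ wire cycles $C_1,\dots,C_m$ (from left to right), each going once around the cylinder and crossing each horizontal wire once, of which $b$ are whirls and $a$ are curls, in some order. Then, for every $j\in\mathbb Z/n\mathbb Z$, the functions $\varepsilon_j$ and $\varphi_j$ of the network crystal $\mathcal X(N^{a,b,\mathrm{id}})$ are rational functions in the boundary measurements of $N^{a,b,\mathrm{id}}$.
   Context: Networks are oriented, with each interior vertex (crossing) having two adjacent incoming and two adjacent outgoing edges. At a crossing let $e_1,e_2,f_1,f_2$ be the edges in counterclockwise order, $e_i$ incoming, $f_i$ outgoing; $e_1,f_1$ is the highway, $e_2,f_2$ the underway. A wire goes straight ($e_1\to f_1$, $e_2\to f_2$) through each crossing. A whirl (curl) is a wire cycle crossed by the other wires from its left (right). The horizontal wires are oriented left to right and numbered cyclically from top to bottom (indices mod $n$), so whirls are oriented up and curls down. The crossing of $W_j$ with $C_k$ has weight $x_k^{(j)}$, regarded as an indeterminate taking values in $\mathbb C^*$; $\mathcal X(N^{a,b,\mathrm{id}})$ is the set of all such weighted networks. Boundary measurements: a highway path is a directed walk that never enters a crossing via $e_2$ and leaves it via $f_2$; its weight is the product, with multiplicity, of the weights of crossings entered via $e_1$ and left via $f_1$. For each source $u$ (left end of a horizontal wire), sink $v$ (right end of a horizontal wire) and each homology class of paths on the cylinder from $u$ to $v$ (two paths are homologous if one followed by the reverse of the other is zero in the first homology of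 the cylinder), the boundary measurement is the sum of the weights of all highway paths from $u$ to $v$ in this class; it is a polynomial in the $x_k^{(j)}$. The functions $\varepsilon_j,\varphi_j$ of $\mathcal X(N^{a,b,\mathrm{id}})$: put $z^{(k)}=x_k^{(j)},\ t^{(k)}=x_k^{(j+1)}$ if $C_k$ is a whirl, and $z^{(k)}=x_k^{(j+1)},\ t^{(k)}=x_k^{(j)}$ if $C_k$ is a curl. With $D=\sum_{s=0}^{m-1}t^{(1)}\cdots t^{(s)}z^{(s+2)}\cdots z^{(m)}$, $$\varphi_j=\frac{\prod_{k=1}^m z^{(k)}}{D},\qquad \varepsilon_j=\frac{\prod_{k=1}^m t^{(k)}}{D}.$$ *)

theory Defs
  imports Complex_Main
begin

section \<open>The network with \<open>n\<close> horizontal wires and one wire cycle per entry of \<open>cs\<close>\<close>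

text \<open>
  The horizontal wires are indexed from top to bottom by \<open>j < n\<close>, standing for the residues mod
  \<open>n\<close>; the wire cycles \<open>C\<^sub>1, \<dots>, C\<^sub>m\<close> are indexed from left to right by \<open>1 \<le> k \<le> m\<close>, where
  \<open>m = length cs\<close> and \<open>cs ! (k - 1)\<close> is the type of \<open>C\<^sub>k\<close>. The pair \<open>(j, k)\<close> is the crossing of the
  \<open>j\<close>-th horizontal wire with \<open>C\<^sub>k\<close>.

  \<open>Hor j k\<close> with \<open>0 \<le> k \<le> m\<close> is the edge of the \<open>j\<close>-th wire between the columns \<open>k\<close> and \<open>k + 1\<close>,
  where the columns \<open>0\<close> and \<open>m + 1\<close> are the left and the right boundary circle; thus \<open>Hor j 0\<close>
  starts at a source and \<open>Hor j m\<close> ends at a sink.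
  \<open>Ver j k\<close> is the arc of column \<open>k\<close> between the wires \<open>j\<close> and \<open>j + 1 mod n\<close>. For \<open>1 \<le> k \<le> m\<close> it is
  an edge of \<open>C\<^sub>k\<close>, going up if \<open>C\<^sub>k\<close> is a whirl and down if \<open>C\<^sub>k\<close> is a curl; for \<open>k = 0\<close> and
  \<open>k = m + 1\<close> it is an arc of the boundary of the cylinder and not an edge of the network.
\<close>

datatype cycle_type = Whirl | Curl

datatype arc = Hor nat nat | Ver nat nat

definition next_wire :: "nat \<Rightarrow> nat \<Rightarrow> nat" where
  "next_wire n j = (j + 1) mod n"

definition prev_wire :: "nat \<Rightarrow> nat \<Rightarrow> nat" where
  "prev_wire n j = (j + n - 1) mod n"

definition kind :: "cycle_type list \<Rightarrow> nat \<Rightarrow> cycle_type" where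
  "kind cs k = cs ! (k - 1)"

definition crossings :: "nat \<Rightarrow> cycle_type list \<Rightarrow> (nat \<times> nat) set" where
  "crossings n cs = {..<n} \<times> {1..length cs}"

text \<open>
  The edges \<open>e\<^sub>1, e\<^sub>2, f\<^sub>1, f\<^sub>2\<close> in counterclockwise order around a crossing: left, below, right, above
  for a whirl (the horizontal wire is the highway) and above, left, below, right for a curl (the
  curl is the highway).
\<close>

fun e1 :: "nat \<Rightarrow> cycle_type list \<Rightarrow> nat \<times> nat \<Rightarrow> arc" where
  "e1 n cs (j, k) = (case kind cs k of Whirl \<Rightarrow> Hor j (k - 1) | Curl \<Rightarrow> Ver (prev_wire n j) k)"

fun e2 :: "nat \<Rightarrow> cycle_type list \<Rightarrow> nat \<times> nat \<Rightarrow> arc" where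
  "e2 n cs (j, k) = (case kind cs k of Whirl \<Rightarrow> Ver j k | Curl \<Rightarrow> Hor j (k - 1))"

fun f1 :: "nat \<Rightarrow> cycle_type list \<Rightarrow> nat \<times> nat \<Rightarrow> arc" where
  "f1 n cs (j, k) = (case kind cs k of Whirl \<Rightarrow> Hor j k | Curl \<Rightarrow> Ver j k)"

fun f2 :: "nat \<Rightarrow> cycle_type list \<Rightarrow> nat \<times> nat \<Rightarrow> arc" where
  "f2 n cs (j, k) = (case kind cs k of Whirl \<Rightarrow> Ver (prev_wire n j) k | Curl \<Rightarrow> Hor j k)"


section \<open>Highway paths and boundary measurements\<close>

text \<open>
  Walks are lists of edges rather than of crossings: for small \<open>n\<close> the network has loops or multiple
  edges.
\<close>

definition directed_walk :: "nat \<Rightarrow> cycle_type list \<Rightarrow> nat \<Rightarrow> nat \<Rightarrow> arc list \<Rightarrow> bool" where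
  "directed_walk n cs u v p \<longleftrightarrow>
     p \<noteq> [] \<and> hd p = Hor u 0 \<and> last p = Hor v (length cs) \<and>
     (\<forall>(e, f) \<in> set (zip p (tl p)). \<exists>c \<in> crossings n cs.
        e \<in> {e1 n cs c, e2 n cs c} \<and> f \<in> {f1 n cs c, f2 n cs c})"

definition highway_paths :: "nat \<Rightarrow> cycle_type list \<Rightarrow> nat \<Rightarrow> nat \<Rightarrow> arc list set" where
  "highway_paths n cs u v = {p. directed_walk n cs u v p \<and>
     (\<forall>c \<in> crossings n cs. (e2 n cs c, f2 n cs c) \<notin> set (zip p (tl p)))}"

text \<open>A weighting \<open>x\<close> assigns \<open>x k j\<close> to the crossing of \<open>C\<^sub>k\<close> with the \<open>j\<close>-th horizontal wire.\<close>

definition path_weight ::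
    "nat \<Rightarrow> cycle_type list \<Rightarrow> arc list \<Rightarrow> (nat \<Rightarrow> nat \<Rightarrow> complex) \<Rightarrow> complex" where
  "path_weight n cs p x =
     (\<Prod>(j, k) \<in> crossings n cs.
        x k j ^ count_list (zip p (tl p)) (e1 n cs (j, k), f1 n cs (j, k)))"

text \<open>
  The first homology of the cylinder is taken cellularly. The 1-cells are the arcs above, with
  \<open>Hor j k\<close> oriented to the right and \<open>Ver j k\<close> oriented downwards; the 2-cells are the faces
  \<open>(j, k)\<close>, \<open>j < n\<close>, \<open>k \<le> m\<close>, bounded by \<open>Hor j k\<close>, \<open>Ver j (k + 1)\<close>, \<open>Hor (j + 1) k\<close>, \<open>Ver j k\<close>.
\<close>

definition face_boundary :: "nat \<Rightarrow> nat \<times> nat \<Rightarrow> arc \<Rightarrow> int" where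
  "face_boundary n = (\<lambda>(j, k) e.
     of_bool (e = Hor j k) + of_bool (e = Ver j (k + 1))
     - of_bool (e = Hor (next_wire n j) k) - of_bool (e = Ver j k))"

fun path_chain :: "cycle_type list \<Rightarrow> arc list \<Rightarrow> arc \<Rightarrow> int" where
  "path_chain cs p (Hor j k) = int (count_list p (Hor j k))"
| "path_chain cs p (Ver j k) =
     (case kind cs k of Whirl \<Rightarrow> - 1 | Curl \<Rightarrow> 1) * int (count_list p (Ver j k))"

definition homologous :: "nat \<Rightarrow> cycle_type list \<Rightarrow> arc list \<Rightarrow> arc list \<Rightarrow> bool" where
  "homologous n cs p q \<longleftrightarrow>
     (\<exists>d :: nat \<times> nat \<Rightarrow> int. \<forall>e. path_chain cs p e - path_chain cs q e =
        (\<Sum>F \<in> {..<n} \<times> {..length cs}. d F * face_boundary n F e))"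

definition homology_rel :: "nat \<Rightarrow> cycle_type list \<Rightarrow> nat \<Rightarrow> nat \<Rightarrow> (arc list \<times> arc list) set" where
  "homology_rel n cs u v =
     {(p, q). p \<in> highway_paths n cs u v \<and> q \<in> highway_paths n cs u v \<and> homologous n cs p q}"

text \<open>Homology classes containing no highway path would contribute only the zero function.\<close>

definition boundary_measurements ::
    "nat \<Rightarrow> cycle_type list \<Rightarrow> ((nat \<Rightarrow> nat \<Rightarrow> complex) \<Rightarrow> complex) set" where
  "boundary_measurements n cs =
     {(\<lambda>x. \<Sum>p \<in> K. path_weight n cs p x) | K u v.
        u < n \<and> v < n \<and> K \<in> highway_paths n cs u v // homology_rel n cs u v}"


section \<open>Homology classes of highway paths are finite\<close>

text \<open>
  This makes the sums in the definition of the boundary measurements sums over finite sets. The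
  proof bounds the number of horizontal and of upward edges of a highway path by \<open>m + 1\<close>; the
  difference of the numbers of downward and upward edges only depends on the homology class.
\<close>

definition steps_ok :: "nat \<Rightarrow> cycle_type list \<Rightarrow> arc list \<Rightarrow> bool" where
  "steps_ok n cs p \<longleftrightarrow> (\<forall>(e, f) \<in> set (zip p (tl p)). \<exists>c \<in> crossings n cs.
        e \<in> {e1 n cs c, e2 n cs c} \<and> f \<in> {f1 n cs c, f2 n cs c} \<and> (e,f) \<noteq> (e2 n cs c, f2 n cs c))"

fun is_hor where "is_hor (Hor j k) = True" | "is_hor (Ver j k) = False"
fun acol where "acol (Hor j k) = k" | "acol (Ver j k) = k"
fun is_up where "is_up cs (Hor j k) = False" | "is_up cs (Ver j k) = (kind cs k = Whirl)"
definition arcs where "arcs n cs = case_prod Hor ` ({..<n} \<times> {..length cs}) \<union> case_prod Ver ` ({..<n} \<times> {..length cs})"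

lemma steps_Cons: "steps_ok n cs (e # f # p) \<longleftrightarrow> (\<exists>c \<in> crossings n cs.
        e \<in> {e1 n cs c, e2 n cs c} \<and> f \<in> {f1 n cs c, f2 n cs c} \<and> (e,f) \<noteq> (e2 n cs c, f2 n cs c)) \<and> steps_ok n cs (f # p)"
  by (auto simp: steps_ok_def)

lemma step_cases:
  assumes "c \<in> crossings n cs" "e \<in> {e1 n cs c, e2 n cs c}" "f \<in> {f1 n cs c, f2 n cs c}" "(e,f) \<noteq> (e2 n cs c, f2 n cs c)"
  shows "e \<in> arcs n cs" "f \<in> arcs n cs" "acol f = acol e + of_bool (is_hor e)" "is_up cs e \<Longrightarrow> is_hor f"
  using assms by (cases c; cases "kind cs (snd c)"; auto simp: crossings_def arcs_def prev_wire_def)+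

lemma bound1:
  "steps_ok n cs p \<Longrightarrow> p \<noteq> [] \<Longrightarrow> last p \<in> arcs n cs \<Longrightarrow> is_hor (last p) \<Longrightarrow>
   set p \<subseteq> arcs n cs \<and> length (filter is_hor p) + acol (hd p) \<le> length cs + 1 \<and>
   length (filter (is_up cs) p) + of_bool (is_hor (hd p)) \<le> length (filter is_hor p)"
proof (induction p)
  case (Cons e p)
  show ?case
  proof (cases p)
    case Nil
    then show ?thesis using Cons by (cases e) (auto simp: arcs_def)
  next
    case (Cons f q)
    note st = Cons.prems(1)[unfolded Cons steps_Cons]
    from st obtain c where c: "c \<in> crossings n cs" "e \<in> {e1 n cs c, e2 n cs c}" "f \<in> {f1 n cs c, f2 n cs c}" "(e,f) \<noteq> (e2 n cs c, f2 n cs c)" by blast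
    have "steps_ok n cs p" using st Cons by blast
    with Cons.IH Cons.prems Cons have IH: "set p \<subseteq> arcs n cs \<and> length (filter is_hor p) + acol (hd p) \<le> length cs + 1 \<and>
   length (filter (is_up cs) p) + of_bool (is_hor (hd p)) \<le> length (filter is_hor p)" by simp
    show ?thesis using IH step_cases[OF c] Cons by (cases e) (auto split: if_splits)
  qed
qed simp


fun is_down where "is_down cs (Hor j k) = False" | "is_down cs (Ver j k) = (kind cs k = Curl)"

abbreviation "net n cs h \<equiv> (\<Sum>(j, k) \<in> {..<n} \<times> {..Suc (length cs)}. h (Ver j k) :: int)"

lemma path_chain_Cons: "path_chain cs (e # p) g = path_chain cs p g + (if e = g then (if is_up cs e then -1 else 1) else 0)"
  by (cases g) (auto split: cycle_type.split)

lemma net_path: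
  "set p \<subseteq> arcs n cs \<Longrightarrow> net n cs (path_chain cs p) = int (length (filter (is_down cs) p)) - int (length (filter (is_up cs) p))"
proof (induction p)
  case Nil
  then show ?case by (auto intro!: sum.neutral)
next
  case (Cons e p)
  have "net n cs (\<lambda>g. if e = g then (if is_up cs e then -1 else 1) else 0) = of_bool (is_down cs e) - of_bool (is_up cs e)"
  proof (cases e)
    case (Hor j k)
    then show ?thesis by (auto intro!: sum.neutral)
  next
    case (Ver j k)
    have "net n cs (\<lambda>g. if e = g then (if is_up cs e then -1 else 1) else 0) =
      (\<Sum>F \<in> {..<n} \<times> {..Suc (length cs)}. if F = (j, k) then (if is_up cs e then -1 else 1) else 0)"
      by (rule sum.cong) (auto simp: Ver split: if_splits)
    also have "\<dots> = (if is_up cs e then -1 else 1)"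
      using Cons.prems Ver by (subst sum.delta) (auto simp: arcs_def)
    finally show ?thesis using Ver by (cases "kind cs k") auto
  qed
  moreover have "net n cs (path_chain cs (e # p)) = net n cs (path_chain cs p)
      + net n cs (\<lambda>g. if e = g then (if is_up cs e then -1 else 1) else 0)"
    by (simp only: path_chain_Cons case_prod_unfold sum.distrib)
  ultimately show ?case using Cons by auto
qed

lemma net_face: "F \<in> {..<n} \<times> {..length cs} \<Longrightarrow> net n cs (face_boundary n F) = 0"
proof -
  assume F: "F \<in> {..<n} \<times> {..length cs}"
  obtain j k where jk: "F = (j,k)" by (cases F)
  have "net n cs (face_boundary n F) = (\<Sum>G \<in> {..<n} \<times> {..Suc (length cs)}. (if G = (j, Suc k) then 1 else 0) - (if G = (j,k) then 1 else 0))"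
    by (rule sum.cong) (auto simp: face_boundary_def jk)
  also have "\<dots> = 0" using F jk by (simp add: sum_subtractf)
  finally show ?thesis .
qed

lemma homologous_net:
  assumes "homologous n cs p q"
  shows "net n cs (path_chain cs p) = net n cs (path_chain cs q)"
proof -
  obtain d :: "nat \<times> nat \<Rightarrow> int" where d: "\<And>e. path_chain cs p e - path_chain cs q e =
        (\<Sum>F \<in> {..<n} \<times> {..length cs}. d F * face_boundary n F e)"
    using assms unfolding homologous_def by blast
  have "net n cs (path_chain cs p) - net n cs (path_chain cs q) =
    net n cs (\<lambda>e. \<Sum>F \<in> {..<n} \<times> {..length cs}. d F * face_boundary n F e)"
    by (simp only: sum_subtractf[symmetric] case_prod_unfold d)
  also have "\<dots> = (\<Sum>F \<in> {..<n} \<times> {..length cs}. d F * net n cs (face_boundary n F))"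
    unfolding case_prod_unfold by (subst sum.swap) (simp add: sum_distrib_left)
  also have "\<dots> = 0" by (intro sum.neutral ballI) (simp only: net_face mult_zero_right)
  finally show ?thesis by simp
qed

lemma length_split: "length p = length (filter is_hor p) + length (filter (is_up cs) p) + length (filter (is_down cs) p)"
proof (induction p)
  case (Cons e p)
  then show ?case by (cases e; cases "kind cs (acol e)") auto
qed simp

lemma highway_bounds:
  assumes "p \<in> highway_paths n cs u v" "v < n"
  shows "set p \<subseteq> arcs n cs" "length (filter is_hor p) \<le> length cs + 1" "length (filter (is_up cs) p) \<le> length cs + 1"
proof -
  have "steps_ok n cs p" "p \<noteq> []" "last p = Hor v (length cs)"
    using assms unfolding highway_paths_def directed_walk_def steps_ok_def by fastforce+
  moreover from this assms(2) have "last p \<in> arcs n cs" "is_hor (last p)"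
    by (auto simp: arcs_def)
  ultimately have "set p \<subseteq> arcs n cs \<and> length (filter is_hor p) + acol (hd p) \<le> length cs + 1 \<and>
   length (filter (is_up cs) p) + of_bool (is_hor (hd p)) \<le> length (filter is_hor p)"
    by (intro bound1)
  then
  show "set p \<subseteq> arcs n cs" "length (filter is_hor p) \<le> length cs + 1" "length (filter (is_up cs) p) \<le> length cs + 1"
    by linarith+
qed

lemma finite_homology_class:
  assumes "v < n" "K \<in> highway_paths n cs u v // homology_rel n cs u v"
  shows "finite K"
proof -
  from assms(2) obtain p where K: "K = homology_rel n cs u v `` {p}" and p: "p \<in> highway_paths n cs u v"
    by (auto elim: quotientE)
  have "K \<subseteq> {q. set q \<subseteq> arcs n cs \<and> length q \<le> 3 * (length cs + 1) + length p}"
  proof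
    fix q assume "q \<in> K"
    then have q: "q \<in> highway_paths n cs u v" "homologous n cs p q" by (auto simp: K homology_rel_def)
    note bp = highway_bounds[OF p assms(1)] and bq = highway_bounds[OF q(1) assms(1)]
    have "int (length (filter (is_down cs) p)) - int (length (filter (is_up cs) p)) =
       int (length (filter (is_down cs) q)) - int (length (filter (is_up cs) q))"
      using homologous_net[OF q(2)] net_path bp(1) bq(1) by metis
    then have "length (filter (is_down cs) p) + length (filter (is_up cs) q) =
       length (filter (is_down cs) q) + length (filter (is_up cs) p)"
      by linarith
    moreover have "length (filter (is_down cs) p) \<le> length p" by simp
    ultimately have "length q \<le> 3 * (length cs + 1) + length p"
      using bp(2,3) bq(2,3) length_split[of q cs] by presburger
    with bq(1) show "q \<in> {q. set q \<subseteq> arcs n cs \<and> length q \<le> 3 * (length cs + 1) + length p}"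
      by blast
  qed
  moreover have "finite (arcs n cs)" by (simp add: arcs_def)
  ultimately show ?thesis using finite_lists_length_le finite_subset by blast
qed


section \<open>The functions \<open>\<epsilon>\<^sub>j\<close> and \<open>\<phi>\<^sub>j\<close>\<close>

definition weightings :: "nat \<Rightarrow> cycle_type list \<Rightarrow> (nat \<Rightarrow> nat \<Rightarrow> complex) set" where
  "weightings n cs = {x. \<forall>(j, k) \<in> crossings n cs. x k j \<noteq> 0}"

definition zpar :: "nat \<Rightarrow> cycle_type list \<Rightarrow> nat \<Rightarrow> (nat \<Rightarrow> nat \<Rightarrow> complex) \<Rightarrow> nat \<Rightarrow> complex" where
  "zpar n cs j x k = (case kind cs k of Whirl \<Rightarrow> x k j | Curl \<Rightarrow> x k (next_wire n j))"

definition tpar :: "nat \<Rightarrow> cycle_type list \<Rightarrow> nat \<Rightarrow> (nat \<Rightarrow> nat \<Rightarrow> complex) \<Rightarrow> nat \<Rightarrow> complex" where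
  "tpar n cs j x k = (case kind cs k of Whirl \<Rightarrow> x k (next_wire n j) | Curl \<Rightarrow> x k j)"

definition crystal_denom ::
    "nat \<Rightarrow> cycle_type list \<Rightarrow> nat \<Rightarrow> (nat \<Rightarrow> nat \<Rightarrow> complex) \<Rightarrow> complex" where
  "crystal_denom n cs j x =
     (\<Sum>s < length cs. (\<Prod>k = 1..s. tpar n cs j x k) * (\<Prod>k = s + 2..length cs. zpar n cs j x k))"

definition crystal_phi ::
    "nat \<Rightarrow> cycle_type list \<Rightarrow> nat \<Rightarrow> (nat \<Rightarrow> nat \<Rightarrow> complex) \<Rightarrow> complex" where
  "crystal_phi n cs j x = (\<Prod>k = 1..length cs. zpar n cs j x k) / crystal_denom n cs j x"

definition crystal_epsilon ::
    "nat \<Rightarrow> cycle_type list \<Rightarrow> nat \<Rightarrow> (nat \<Rightarrow> nat \<Rightarrow> complex) \<Rightarrow> complex" where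
  "crystal_epsilon n cs j x = (\<Prod>k = 1..length cs. tpar n cs j x k) / crystal_denom n cs j x"


section \<open>Rational functions in a set of functions\<close>

inductive_set polynomials_in :: "('w \<Rightarrow> complex) set \<Rightarrow> ('w \<Rightarrow> complex) set"
  for S :: "('w \<Rightarrow> complex) set" where
  const: "(\<lambda>_. c) \<in> polynomials_in S"
| gen: "f \<in> S \<Longrightarrow> f \<in> polynomials_in S"
| add: "f \<in> polynomials_in S \<Longrightarrow> g \<in> polynomials_in S \<Longrightarrow> (\<lambda>x. f x + g x) \<in> polynomials_in S"
| mult: "f \<in> polynomials_in S \<Longrightarrow> g \<in> polynomials_in S \<Longrightarrow> (\<lambda>x. f x * g x) \<in> polynomials_in S"

text \<open>
  In the application \<open>X\<close> is the torus of weightings and \<open>S\<close> consists of polynomials, so that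
  \<open>q\<close> not vanishing identically on \<open>X\<close> means that it vanishes only on a proper subvariety.
  For \<open>\<epsilon>\<^sub>j\<close> and \<open>\<phi>\<^sub>j\<close> the convention \<open>a / 0 = 0\<close> is harmless: their numerators have no zeros on the
  torus, so if \<open>m > 0\<close> and \<open>p / q\<close> represents one of them as a rational function, then \<open>q\<close> vanishes
  wherever their denominator does.
\<close>

definition rational_in :: "'w set \<Rightarrow> ('w \<Rightarrow> complex) set \<Rightarrow> ('w \<Rightarrow> complex) \<Rightarrow> bool" where
  "rational_in X S f \<longleftrightarrow>
     (\<exists>p \<in> polynomials_in S. \<exists>q \<in> polynomials_in S.
        (\<exists>x \<in> X. q x \<noteq> 0) \<and> (\<forall>x \<in> X. q x \<noteq> 0 \<longrightarrow> f x = p x / q x))"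

end

theory Submission
  imports Defs "Jordan_Normal_Form.Determinant"
begin

text \<open>
  Cut the cylinder open along its axis. A position \<open>p\<close> on the line stands for the wire \<open>p mod n\<close>, and
  the position reached by a path that starts at position \<open>P\<close> records its sink and its homology class.
  So a boundary measurement is an entry of an operator on sequences \<open>f\<close> of numbers indexed by positions,
  namely of the product of one operator per wire cycle. Write \<open>E f p = f (p + 1)\<close> and let \<open>X\<close> be the
  multiplication by the weights of the column. A whirl acts by \<open>X + E\<close>; a curl acts by
  \<open>(E - X)\<inverse>\<close>, expanded so that paths run downwards (\<open>flow\<close>, \<open>flow_boundary_measurement\<close>).

  If \<open>(E - X)\<inverse>\<close> is expanded the other way, so that positions only decrease, every column becomes
  triangular. Restricted to the two adjacent positions \<open>P\<close> and \<open>P + 1\<close> over \<open>j\<close> and \<open>j + 1\<close>, each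
  column is then, up to a scalar, the matrix with diagonal entries \<open>z\<close>, \<open>t\<close> and off-diagonal entry \<open>1\<close>,
  and the product of these matrices has the diagonal entries \<open>\<Prod>z\<close>, \<open>\<Prod>t\<close> and the off-diagonal entry
  \<open>D\<close>. Hence \<open>\<phi>\<^sub>j\<close> and \<open>\<epsilon>\<^sub>j\<close> are ratios of entries of the product in its other expansion.

  The two expansions are compared by clearing denominators. Let \<open>N\<close> be a period of the weights and
  \<open>y\<^sub>k\<close> the product of the weights of \<open>C\<^sub>k\<close> over one period. There is a polynomial \<open>A\<close> in \<open>E\<close> and \<open>X\<close>
  with \<open>A (E - X) = E\<^sup>N - y\<^sub>k\<close>, and \<open>E\<^sup>N\<close> commutes with all columns. So
  \<open>R = \<Prod>\<^sub>k (E\<^sup>N - y\<^sub>k)\<close>, over the curls, turns the flow into a sequence that vanishes beyond the source.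
  Up to a common nonzero factor, its values at the sources \<open>P\<close> and \<open>P + 1\<close> are \<open>\<Prod>z\<close> and \<open>\<Prod>t\<close>, and its value
  at \<open>P\<close> for the source \<open>P + 1\<close> is \<open>D\<close>
  (\<open>shift_poly_flow\<close>, \<open>cleared_flow_top\<close>, \<open>cleared_flow_Suc_top\<close>, \<open>cleared_flow_Suc_below_top\<close>).
  The period is taken to be \<open>N = 2n\<close>: then \<open>P\<close> and \<open>P + 1\<close> are not congruent mod \<open>N\<close>, even for
  \<open>n = 1\<close>, and \<open>A\<close> has the expected entries there.

  The coefficients of \<open>R\<close> are not boundary measurements, but the vanishing beyond the source is a
  linear system for them whose coefficients are. Eliminating them by a bordered determinant
  (\<open>det_bordered\<close>) expresses \<open>H \<Prod>z\<close>, \<open>H \<Prod>t\<close> and \<open>H D\<close>, up to the common factor, as polynomials in the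
  boundary measurements, where \<open>H\<close> is a Hankel determinant of boundary measurements. Finally \<open>H\<close> does
  not vanish identically: when all weights of \<open>C\<^sub>k\<close> equal \<open>k\<close>, the flow beyond the source is a sum of
  exponentials with distinct bases, one for each curl, and nonzero coefficients
  (\<open>flow_homogeneous\<close>, \<open>hankel_det_nonzero\<close>).
\<close>


section \<open>Flows on the universal cover\<close>

text \<open>
  At a whirl the path either goes straight on, or comes up from the next wire.
\<close>
definition whirl_op :: "(nat \<Rightarrow> 'a::comm_ring_1) \<Rightarrow> (nat \<Rightarrow> 'a) \<Rightarrow> nat \<Rightarrow> 'a" where
  "whirl_op X f p = X p * f p + f (Suc p)"

text \<open>
  At a curl the path leaves the column at \<open>p + 1\<close> after turning down from \<open>p\<close>, or after passing
  the crossing at \<open>p\<close> on the curl. This is the solution \<open>g\<close> of \<open>(E - X) g = f\<close> that vanishes at \<open>0\<close>.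
\<close>
primrec curl_op :: "(nat \<Rightarrow> 'a::comm_ring_1) \<Rightarrow> (nat \<Rightarrow> 'a) \<Rightarrow> nat \<Rightarrow> 'a" where
  "curl_op X f 0 = 0"
| "curl_op X f (Suc p) = f p + X p * curl_op X f p"

text \<open>
  Positions are natural numbers. Each column moves a path up by at most one position, so no path
  leaves this range when the start \<open>P\<close> is at least the number of columns.
\<close>
primrec flow ::
    "cycle_type list \<Rightarrow> (nat \<Rightarrow> nat \<Rightarrow> 'a::comm_ring_1) \<Rightarrow> nat \<Rightarrow> nat \<Rightarrow> nat \<Rightarrow> 'a" where
  "flow cs X P 0 = (\<lambda>p. of_bool (p = P))"
| "flow cs X P (Suc k) = (case kind cs (Suc k) of
     Whirl \<Rightarrow> whirl_op (X (Suc k)) (flow cs X P k) | Curl \<Rightarrow> curl_op (X (Suc k)) (flow cs X P k))"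

text \<open>
  The operator \<open>A = (E\<^sup>N - y) (E - X)\<inverse>\<close>, where \<open>y\<close> is the product of \<open>X\<close> over one period.
\<close>
definition cleared_curl_op :: "nat \<Rightarrow> (nat \<Rightarrow> 'a::comm_ring_1) \<Rightarrow> (nat \<Rightarrow> 'a) \<Rightarrow> nat \<Rightarrow> 'a" where
  "cleared_curl_op N X f p = (\<Sum>s<N. (\<Prod>l = p + s + 1..<p + N. X l) * f (p + s))"

primrec cleared_flow ::
    "cycle_type list \<Rightarrow> nat \<Rightarrow> (nat \<Rightarrow> nat \<Rightarrow> 'a::comm_ring_1) \<Rightarrow> nat \<Rightarrow> nat \<Rightarrow> nat \<Rightarrow> 'a" where
  "cleared_flow cs N X P 0 = (\<lambda>p. of_bool (p = P))"
| "cleared_flow cs N X P (Suc k) = (case kind cs (Suc k) of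
     Whirl \<Rightarrow> whirl_op (X (Suc k)) (cleared_flow cs N X P k)
   | Curl \<Rightarrow> cleared_curl_op N (X (Suc k)) (cleared_flow cs N X P k))"

primrec recurrence_poly ::
    "cycle_type list \<Rightarrow> nat \<Rightarrow> (nat \<Rightarrow> nat \<Rightarrow> 'a::idom) \<Rightarrow> nat \<Rightarrow> 'a poly" where
  "recurrence_poly cs N X 0 = 1"
| "recurrence_poly cs N X (Suc k) = (case kind cs (Suc k) of
     Whirl \<Rightarrow> recurrence_poly cs N X k
   | Curl \<Rightarrow> [:- (\<Prod>l<N. X (Suc k) l), 1:] * recurrence_poly cs N X k)"

definition curl_columns :: "cycle_type list \<Rightarrow> nat \<Rightarrow> nat set" where
  "curl_columns cs k = {l \<in> {1..k}. kind cs l = Curl}"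

lemma finite_curl_columns [simp]: "finite (curl_columns cs k)"
  by (simp add: curl_columns_def)

lemma curl_columns_0 [simp]: "curl_columns cs 0 = {}"
  by (simp add: curl_columns_def)

lemma curl_columns_Suc:
  "curl_columns cs (Suc k) =
     (case kind cs (Suc k) of Whirl \<Rightarrow> curl_columns cs k | Curl \<Rightarrow> insert (Suc k) (curl_columns cs k))"
  by (auto simp: curl_columns_def le_Suc_eq split: cycle_type.split)

lemma Suc_notin_curl_columns [simp]: "Suc k \<notin> curl_columns cs k"
  by (simp add: curl_columns_def)

lemma lead_coeff_recurrence_poly: "lead_coeff (recurrence_poly cs N X k) = 1"
proof (induction k)
  case (Suc k)
  have "lead_coeff ([:- y, 1:] * recurrence_poly cs N X k) = 1" for y
    unfolding lead_coeff_mult Suc by simp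
  with Suc show ?case by (cases "kind cs (Suc k)") (simp_all del: mult_pCons_left)
qed simp

lemma degree_recurrence_poly: "degree (recurrence_poly cs N X k) = card (curl_columns cs k)"
proof (induction k)
  case (Suc k)
  have "recurrence_poly cs N X k \<noteq> 0"
    using lead_coeff_recurrence_poly[of cs N X k] by auto
  then have "degree ([:- y, 1:] * recurrence_poly cs N X k) = Suc (card (curl_columns cs k))" for y
    using Suc by (simp add: degree_mult_eq del: mult_pCons_left)
  with Suc show ?case
    by (cases "kind cs (Suc k)") (simp_all add: curl_columns_Suc del: mult_pCons_left)
qed simp

text \<open>
  The action of the polynomial \<open>r\<close> on sequences with the indeterminate acting by \<open>E\<^sup>N\<close>.
\<close>
definition shift_poly :: "nat \<Rightarrow> 'a::comm_ring_1 poly \<Rightarrow> (nat \<Rightarrow> 'a) \<Rightarrow> nat \<Rightarrow> 'a" where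
  "shift_poly N r f p = (\<Sum>i\<le>degree r. coeff r i * f (p + N * i))"

lemma shift_poly_bound:
  assumes "degree r \<le> d"
  shows "shift_poly N r f p = (\<Sum>i\<le>d. coeff r i * f (p + N * i))"
  unfolding shift_poly_def
  by (rule sum.mono_neutral_left) (use assms in \<open>auto simp: coeff_eq_0\<close>)

lemma shift_poly_linear_factor:
  "shift_poly N ([:- y, 1:] * r) f = shift_poly N r (\<lambda>p. f (p + N) - y * f p)"
proof
  fix p
  let ?d = "degree r"
  have d: "degree ([:- y, 1:] * r) \<le> Suc ?d"
    using degree_mult_le[of "[:- y, 1:]" r] by (auto intro: le_trans)
  have "shift_poly N ([:- y, 1:] * r) f p =
      (\<Sum>i\<le>Suc ?d. - y * (coeff r i * f (p + N * i)))
      + (\<Sum>i\<le>Suc ?d. coeff (pCons 0 r) i * f (p + N * i))"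
    unfolding shift_poly_bound[OF d] by (simp only: sum.distrib[symmetric])
      (auto simp: algebra_simps intro!: sum.cong)
  also have "(\<Sum>i\<le>Suc ?d. - y * (coeff r i * f (p + N * i))) =
      (\<Sum>i\<le>?d. - y * (coeff r i * f (p + N * i)))"
    by (simp add: coeff_eq_0)
  also have "(\<Sum>i\<le>Suc ?d. coeff (pCons 0 r) i * f (p + N * i)) =
      (\<Sum>i\<le>?d. coeff r i * f (p + N * i + N))"
    by (subst sum.atMost_Suc_shift) (simp add: algebra_simps)
  finally show "shift_poly N ([:- y, 1:] * r) f p = shift_poly N r (\<lambda>p. f (p + N) - y * f p) p"
    by (simp add: shift_poly_def sum.distrib[symmetric] algebra_simps)
qed

definition periodic :: "nat \<Rightarrow> (nat \<Rightarrow> 'a) \<Rightarrow> bool" where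
  "periodic N X \<longleftrightarrow> (\<forall>l. X (l + N) = X l)"

lemma periodic_mult:
  assumes "periodic N X"
  shows "X (l + N * i) = X l"
proof (induction i)
  case 0
  then show ?case by simp
next
  case (Suc i)
  have "X (l + N * Suc i) = X (l + N * i + N)" by (simp add: algebra_simps)
  with Suc assms show ?case by (simp add: periodic_def)
qed

lemma prod_period:
  fixes X :: "nat \<Rightarrow> 'a::comm_ring_1"
  assumes "periodic N X"
  shows "(\<Prod>l = p..<p + N. X l) = (\<Prod>l<N. X l)"
proof (induction p)
  case 0
  then show ?case by (simp add: atLeast0LessThan)
next
  case (Suc p)
  show ?case
  proof (cases "N = 0")
    case False
    then have "(\<Prod>l = Suc p..<Suc p + N. X l) = (\<Prod>l = Suc p..<p + N. X l) * X (p + N)"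
      by simp
    also have "\<dots> = (\<Prod>l = p..<p + N. X l)"
      using False by (simp add: assms[unfolded periodic_def] prod.atLeast_Suc_lessThan[of p])
    finally show ?thesis using Suc by simp
  qed simp
qed

lemma curl_op_add:
  "curl_op X f (p + t) = (\<Prod>l = p..<p + t. X l) * curl_op X f p
     + (\<Sum>s<t. (\<Prod>l = p + s + 1..<p + t. X l) * f (p + s))"
proof (induction t)
  case (Suc t)
  have "(\<Sum>s<t. (\<Prod>l = p + s + 1..<p + Suc t. X l) * f (p + s)) =
      X (p + t) * (\<Sum>s<t. (\<Prod>l = p + s + 1..<p + t. X l) * f (p + s))"
    unfolding sum_distrib_left by (rule sum.cong) (auto simp: algebra_simps)
  with Suc show ?case by (simp add: algebra_simps)
qed simp

text \<open>
  Unrolling the recursion of the curl over one whole period multiplies the old value by \<open>y\<close>.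
\<close>
lemma curl_op_clear:
  assumes "periodic N X"
  shows "(\<lambda>p. curl_op X f (p + N) - (\<Prod>l<N. X l) * curl_op X f p) = cleared_curl_op N X f"
  by (rule ext) (simp only: curl_op_add prod_period[OF assms] cleared_curl_op_def add_diff_cancel_left')

lemma shift_poly_whirl_op:
  assumes "periodic N X"
  shows "shift_poly N r (whirl_op X f) = whirl_op X (shift_poly N r f)"
  by (rule ext) (simp add: shift_poly_def whirl_op_def periodic_mult[OF assms] sum.distrib
      sum_distrib_left distrib_left mult.left_commute)

lemma shift_poly_cleared_curl_op:
  assumes "periodic N X"
  shows "shift_poly N r (cleared_curl_op N X f) = cleared_curl_op N X (shift_poly N r f)"
proof
  fix p
  have *: "(\<Prod>l = p + N * i + s + 1..<p + N * i + N. X l) = (\<Prod>l = p + s + 1..<p + N. X l)" for i s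
    using prod.shift_bounds_nat_ivl[of X "p + s + 1" "N * i" "p + N"]
    by (simp add: periodic_mult[OF assms] algebra_simps)
  have "shift_poly N r (cleared_curl_op N X f) p =
      (\<Sum>i\<le>degree r. \<Sum>s<N. coeff r i * ((\<Prod>l = p + s + 1..<p + N. X l) * f (p + N * i + s)))"
    by (simp only: shift_poly_def cleared_curl_op_def * sum_distrib_left)
  also have "\<dots> = cleared_curl_op N X (shift_poly N r f) p"
    by (subst sum.swap) (simp add: shift_poly_def cleared_curl_op_def sum_distrib_left algebra_simps)
  finally show "shift_poly N r (cleared_curl_op N X f) p = cleared_curl_op N X (shift_poly N r f) p" .
qed

text \<open>
  The shift by a period commutes with every column, so that the linear factors of the recurrence
  polynomial can be applied one at a time, each next to the curl whose denominator it clears.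
\<close>
lemma shift_poly_flow:
  assumes "\<And>k. periodic N (X k)"
  shows "shift_poly N (recurrence_poly cs N X k) (flow cs X P k) = cleared_flow cs N X P k"
proof (induction k)
  case 0
  show ?case by (rule ext) (simp add: shift_poly_def)
next
  case (Suc k)
  show ?case
  proof (cases "kind cs (Suc k)")
    case Whirl
    then show ?thesis by (simp add: shift_poly_whirl_op[OF assms] Suc)
  next
    case Curl
    then show ?thesis
      by (simp add: shift_poly_linear_factor curl_op_clear[OF assms]
          shift_poly_cleared_curl_op[OF assms] Suc del: mult_pCons_left)
  qed
qed

text \<open>
  After clearing, no column moves anything to a higher position.
\<close>
lemma cleared_flow_above:
  "P < p \<Longrightarrow> cleared_flow cs N X P k p = 0"
  by (induction k arbitrary: p) (auto simp: whirl_op_def cleared_curl_op_def split: cycle_type.split)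

text \<open>
  The common factor by which a cleared curl differs from the \<open>2 \<times> 2\<close> matrix with diagonal \<open>z\<close>, \<open>t\<close>.
\<close>
definition curl_factor :: "cycle_type list \<Rightarrow> nat \<Rightarrow> (nat \<Rightarrow> nat \<Rightarrow> 'a::comm_ring_1) \<Rightarrow> nat \<Rightarrow> nat \<Rightarrow> 'a" where
  "curl_factor cs N X P k = (case kind cs k of Whirl \<Rightarrow> 1 | Curl \<Rightarrow> \<Prod>l = P + 2..<P + N. X k l)"

text \<open>
  The parameters \<open>z\<close> and \<open>t\<close> of column \<open>k\<close>, for the wires at the positions \<open>P\<close> and \<open>P + 1\<close>.
\<close>
definition zflow where
  "zflow cs X P k = (case kind cs k of Whirl \<Rightarrow> X k P | Curl \<Rightarrow> X k (Suc P))"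

definition tflow where
  "tflow cs X P k = (case kind cs k of Whirl \<Rightarrow> X k (Suc P) | Curl \<Rightarrow> X k P)"

text \<open>
  Only the two lowest terms of the sum meet the support of \<open>f\<close>. With \<open>N = 1\<close> the second of them
  would be missing.
\<close>
lemma cleared_curl_op_top:
  assumes "2 \<le> N" "\<And>p. Suc p' < p \<Longrightarrow> f p = 0"
  shows "cleared_curl_op N X f p' = (\<Prod>l = p' + 2..<p' + N. X l) * (X (Suc p') * f p' + f (Suc p'))"
proof -
  obtain N' where N: "N = Suc (Suc N')" using assms(1) by (metis Suc_le_D numeral_2_eq_2 Suc_le_mono)
  have "(\<Prod>l = Suc p'..<p' + N. X l) = X (Suc p') * (\<Prod>l = p' + 2..<p' + N. X l)"
    by (subst prod.atLeast_Suc_lessThan) (auto simp: N)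
  moreover have "(\<Sum>s<N'. (\<Prod>l = p' + Suc (Suc s) + 1..<p' + N. X l) * f (p' + Suc (Suc s))) = 0"
    by (intro sum.neutral) (auto simp: assms(2))
  ultimately show ?thesis
    unfolding cleared_curl_op_def by (subst (1) N, subst sum.lessThan_Suc_shift, subst sum.lessThan_Suc_shift)
      (simp add: algebra_simps)
qed

lemma cleared_flow_top:
  assumes "2 \<le> N"
  shows "cleared_flow cs N X P k P = (\<Prod>i = 1..k. curl_factor cs N X P i * zflow cs X P i)"
proof (induction k)
  case (Suc k)
  show ?case
  proof (cases "kind cs (Suc k)")
    case Whirl
    then show ?thesis by (simp add: whirl_op_def cleared_flow_above Suc curl_factor_def zflow_def)
  next
    case Curl
    then show ?thesis
      by (simp add: cleared_curl_op_top[OF assms] cleared_flow_above Suc curl_factor_def zflow_def)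
  qed
qed simp

text \<open>
  The product of weights left out one position further starts and ends one position later; by
  periodicity the weight gained at \<open>P + N\<close> is the one at \<open>P\<close>, which is \<open>t\<close> for a curl.
\<close>
lemma cleared_flow_Suc_top:
  assumes N: "2 \<le> N" and per: "\<And>k. periodic N (X k)"
  shows "cleared_flow cs N X (Suc P) k (Suc P) = (\<Prod>i = 1..k. curl_factor cs N X P i * tflow cs X P i)"
proof -
  have "curl_factor cs N X (Suc P) i * zflow cs X (Suc P) i = curl_factor cs N X P i * tflow cs X P i" for i
  proof (cases "kind cs i")
    case Whirl
    then show ?thesis by (simp add: curl_factor_def zflow_def tflow_def)
  next
    case Curl
    have "X i (Suc (Suc P)) * (\<Prod>l = Suc P + 2..<Suc P + N. X i l) = (\<Prod>l = P + 2..<P + N. X i l) * X i (P + N)"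
      using N prod.atLeast_Suc_lessThan[of "P + 2" "Suc P + N" "X i"] by simp
    with Curl per[unfolded periodic_def] show ?thesis by (simp add: curl_factor_def zflow_def tflow_def mult.commute)
  qed
  then show ?thesis by (simp only: cleared_flow_top[OF N])
qed

text \<open>
  The denominator of the crystal functions is the off-diagonal entry of a product of triangular
  \<open>2 \<times> 2\<close> matrices: its \<open>s\<close>-th term comes from the path that descends in column \<open>s + 1\<close>.
\<close>
lemma cleared_flow_Suc_below_top:
  assumes N: "2 \<le> N" and per: "\<And>k. periodic N (X k)"
  shows "cleared_flow cs N X (Suc P) k P = (\<Prod>i = 1..k. curl_factor cs N X P i) *
     (\<Sum>s<k. (\<Prod>i = 1..s. tflow cs X P i) * (\<Prod>i = s + 2..k. zflow cs X P i))"
proof (induction k)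
  case (Suc k)
  have "cleared_flow cs N X (Suc P) (Suc k) P = curl_factor cs N X P (Suc k) *
     (zflow cs X P (Suc k) * cleared_flow cs N X (Suc P) k P + cleared_flow cs N X (Suc P) k (Suc P))"
    by (cases "kind cs (Suc k)")
      (simp_all add: whirl_op_def cleared_flow_above curl_factor_def zflow_def cleared_curl_op_top[OF N])
  moreover have "(\<Sum>s<k. (\<Prod>i = 1..s. tflow cs X P i) * (\<Prod>i = s + 2..Suc k. zflow cs X P i)) =
      (\<Sum>s<k. (\<Prod>i = 1..s. tflow cs X P i) * (\<Prod>i = s + 2..k. zflow cs X P i)) * zflow cs X P (Suc k)"
    unfolding sum_distrib_right by (rule sum.cong) auto
  ultimately show ?case
    unfolding Suc cleared_flow_Suc_top[OF assms] by (simp add: prod.distrib algebra_simps)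
qed simp


section \<open>Determinants\<close>

lemma polynomials_in_sum:
  assumes "\<And>i. i \<in> I \<Longrightarrow> f i \<in> polynomials_in S"
  shows "(\<lambda>x. \<Sum>i\<in>I. f i x) \<in> polynomials_in S"
  using assms
  by (induction I rule: infinite_finite_induct) (auto intro: polynomials_in.intros)

lemma polynomials_in_prod:
  assumes "\<And>i. i \<in> I \<Longrightarrow> f i \<in> polynomials_in S"
  shows "(\<lambda>x. \<Prod>i\<in>I. f i x) \<in> polynomials_in S"
  using assms
  by (induction I rule: infinite_finite_induct) (auto intro: polynomials_in.intros)

lemma polynomials_in_det:
  assumes "\<And>i j. i < d \<Longrightarrow> j < d \<Longrightarrow> M i j \<in> polynomials_in S"
  shows "(\<lambda>x. det (mat d d (\<lambda>(i, j). M i j x))) \<in> polynomials_in S"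
proof -
  have "(\<lambda>x. det (mat d d (\<lambda>(i, j). M i j x))) =
      (\<lambda>x. \<Sum>\<pi> \<in> {\<pi>. \<pi> permutes {0..<d}}. signof \<pi> * (\<Prod>i = 0..<d. M i (\<pi> i) x))"
    by (auto simp: det_def intro!: sum.cong prod.cong ext)
  moreover have "(\<lambda>x. \<Sum>\<pi> \<in> {\<pi>. \<pi> permutes {0..<d}}. signof \<pi> * (\<Prod>i = 0..<d. M i (\<pi> i) x))
      \<in> polynomials_in S"
    by (intro polynomials_in_sum polynomials_in.mult polynomials_in.const polynomials_in_prod assms)
      (auto dest: permutes_in_image)
  ultimately show ?thesis by simp
qed

text \<open>
  Column operations with the coefficients \<open>w\<close> clear the last column except for its last entry. This
  is Cramer's rule in a form that yields one linear combination of the solution directly.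
\<close>
lemma det_bordered:
  fixes c :: "nat \<Rightarrow> nat \<Rightarrow> 'a::comm_ring_1"
  assumes "\<And>i. i < d \<Longrightarrow> (\<Sum>j\<le>d. c i j * w j) = 0" and "w d = 1"
  shows "det (mat (Suc d) (Suc d) (\<lambda>(i, j). c i j)) =
    det (mat d d (\<lambda>(i, j). c i j)) * (\<Sum>j\<le>d. c d j * w j)"
proof -
  let ?n = "Suc d"
  let ?M = "mat ?n ?n (\<lambda>(i, j). c i j)"
  let ?U = "mat ?n ?n (\<lambda>(i, j). if j = d then w i else of_bool (i = j))"
  let ?V = "mat ?n ?n (\<lambda>(i, j). if j = d then of_bool (i = d) * (\<Sum>j\<le>d. c d j * w j) else c i j)"
  have "det ?U = prod_list (diag_mat ?U)"
    by (rule det_upper_triangular[of _ ?n]) auto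
  also have "\<dots> = 1"
    by (auto simp: prod_list_diag_prod assms(2) intro!: prod.neutral)
  finally have U: "det ?U = 1" .
  have MU: "?M * ?U = ?V"
  proof (rule eq_matI)
    fix i j assume ij: "i < dim_row ?V" "j < dim_col ?V"
    then have "(?M * ?U) $$ (i, j) = (\<Sum>k<?n. c i k * (if j = d then w k else of_bool (k = j)))"
      by (auto simp: scalar_prod_def atLeast0LessThan intro!: sum.cong)
    also have "\<dots> = ?V $$ (i, j)"
    proof (cases "j = d")
      case True
      then show ?thesis using ij assms(1)[of i]
        by (cases "i = d") (auto simp: lessThan_Suc_atMost)
    next
      case False
      have "(\<Sum>k<?n. c i k * of_bool (k = j)) = (\<Sum>k<?n. if k = j then c i k else 0)"
        by (rule sum.cong) auto
      with False ij show ?thesis by (simp del: sum.lessThan_Suc)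
    qed
    finally show "(?M * ?U) $$ (i, j) = ?V $$ (i, j)" .
  qed auto
  have "det ?M = det (?M * ?U)"
    by (subst det_mult[of _ ?n]) (auto simp: U)
  also have "\<dots> = (\<Sum>i<?n. ?V $$ (i, d) * cofactor ?V i d)"
    unfolding MU by (rule laplace_expansion_column[of _ ?n]) auto
  also have "\<dots> = ?V $$ (d, d) * cofactor ?V d d"
    by (simp add: sum.neutral)
  also have "mat_delete ?V d d = mat d d (\<lambda>(i, j). c i j)"
    by (rule eq_matI) (auto simp: mat_delete_def)
  then have "cofactor ?V d d = det (mat d d (\<lambda>(i, j). c i j))"
    by (simp add: cofactor_def)
  finally show ?thesis by (simp add: mult.commute)
qed


text \<open>
  The Hankel matrix of \<open>s\<close> is \<open>V\<^sup>T diag(C) V\<close> for a square Vandermonde matrix \<open>V\<close>. A kernel vector is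
  a polynomial of degree below \<open>card L\<close>; testing against Lagrange polynomials shows that it vanishes
  at the \<open>card L\<close> distinct points \<open>Y l\<close>.
\<close>
lemma hankel_det_nonzero:
  fixes C Y :: "'i \<Rightarrow> 'a::field"
  assumes fin: "finite L" and nz: "\<And>l. l \<in> L \<Longrightarrow> C l \<noteq> 0" and inj: "inj_on Y L"
    and s: "\<And>i. s i = (\<Sum>l\<in>L. C l * Y l ^ i)"
  shows "det (mat (card L) (card L) (\<lambda>(i, j). s (i + j))) \<noteq> 0"
proof
  let ?a = "card L"
  let ?H = "mat ?a ?a (\<lambda>(i, j). s (i + j))"
  assume "det ?H = 0"
  then obtain v where v: "v \<in> carrier_vec ?a" "v \<noteq> 0\<^sub>v ?a" "?H *\<^sub>v v = 0\<^sub>v ?a"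
    by (subst (asm) det_0_iff_vec_prod_zero_field[of _ ?a]) auto
  define V where "V y = (\<Sum>j<?a. v $ j * y ^ j)" for y
  have eq0: "(\<Sum>l\<in>L. C l * V (Y l) * Y l ^ i) = 0" if "i < ?a" for i
  proof -
    have "0 = (?H *\<^sub>v v) $ i" using that v by simp
    also have "\<dots> = (\<Sum>j<?a. s (i + j) * v $ j)"
      using that v(1) by (simp add: scalar_prod_def atLeast0LessThan)
    also have "\<dots> = (\<Sum>j<?a. \<Sum>l\<in>L. C l * Y l ^ i * (v $ j * Y l ^ j))"
      by (simp add: s sum_distrib_left power_add mult_ac)
    also have "\<dots> = (\<Sum>l\<in>L. C l * V (Y l) * Y l ^ i)"
      by (subst sum.swap) (simp add: V_def sum_distrib_left mult_ac)
    finally show ?thesis by simp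
  qed
  have Vroot: "V (Y l) = 0" if l: "l \<in> L" for l
  proof -
    \<comment> \<open>The Lagrange polynomial at \<open>Y l\<close>, up to a scalar.\<close>
    define g where "g = (\<Prod>l'\<in>L - {l}. [:- Y l', 1:])"
    have "degree g \<le> (\<Sum>l'\<in>L - {l}. 1)"
      unfolding g_def by (rule order.trans[OF degree_prod_sum_le]) (use fin in auto)
    then have deg: "degree g < ?a"
      using l fin card_gt_0_iff[of L] by (auto simp: card_Diff_singleton)
    have g_other: "poly g (Y l') = 0" if "l' \<in> L - {l}" for l'
      using that fin by (auto simp: g_def poly_prod intro!: prod_zero)
    have g_l: "poly g (Y l) \<noteq> 0"
      using inj l fin by (auto simp: g_def poly_prod prod_zero_iff dest: inj_onD)
    have "0 = (\<Sum>i\<le>degree g. coeff g i * (\<Sum>l\<in>L. C l * V (Y l) * Y l ^ i))"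
      using deg by (simp add: eq0)
    also have "\<dots> = (\<Sum>l\<in>L. C l * V (Y l) * poly g (Y l))"
      unfolding sum_distrib_left by (subst sum.swap) (simp add: poly_altdef sum_distrib_left mult_ac)
    also have "\<dots> = C l * V (Y l) * poly g (Y l)"
      by (subst sum.remove[OF fin l]) (simp add: g_other sum.neutral)
    finally show ?thesis using g_l nz[OF l] by simp
  qed
  \<comment> \<open>The kernel vector as a polynomial: it has more roots than its degree allows.\<close>
  define q where "q = (\<Sum>j<?a. monom (v $ j) j)"
  have "poly q y = V y" for y by (simp add: q_def V_def poly_sum poly_monom)
  have coeff_q: "coeff q j = v $ j" if "j < ?a" for j
    using that by (simp add: q_def coeff_sum)
  have "q = 0"
  proof (rule ccontr)
    assume "q \<noteq> 0"
    have "?a = card (Y ` L)" by (simp add: card_image inj)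
    also have "\<dots> \<le> card {y. poly q y = 0}"
      by (rule card_mono) (use poly_roots_finite[OF \<open>q \<noteq> 0\<close>] \<open>\<And>y. poly q y = V y\<close> Vroot in auto)
    also have "\<dots> \<le> degree q" by (rule card_poly_roots_bound) fact
    finally have "?a \<le> degree q" .
    moreover have "degree q < ?a" if "0 < ?a"
      unfolding q_def by (rule degree_sum_less) (auto intro: le_less_trans[OF degree_monom_le] that)
    moreover have "0 < ?a" using \<open>q \<noteq> 0\<close> by (cases "?a = 0") (auto simp: q_def)
    ultimately show False by simp
  qed
  then have "v = 0\<^sub>v ?a" using v(1) coeff_q by (intro eq_vecI) (metis coeff_0 index_zero_vec(1) carrier_vecD index_zero_vec(2))+
  with v(2) show False by simp
qed


section \<open>Highway steps\<close>

lemma next_prev_wire [simp]: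
  assumes "j < n"
  shows "next_wire n (prev_wire n j) = j" "prev_wire n (next_wire n j) = j"
    "prev_wire n j < n" "next_wire n j < n"
proof -
  show "prev_wire n j < n" "next_wire n j < n"
    using assms by (auto simp: prev_wire_def next_wire_def)
  show "next_wire n (prev_wire n j) = j"
    using assms by (cases j) (auto simp: next_wire_def prev_wire_def)
  show "prev_wire n (next_wire n j) = j"
    using assms by (cases "Suc j = n") (auto simp: next_wire_def prev_wire_def)
qed

lemma next_wire_eq_iff: "i < n \<Longrightarrow> j < n \<Longrightarrow> next_wire n j = i \<longleftrightarrow> j = prev_wire n i"
  by auto

lemma next_wire_mod: "next_wire n (p mod n) = Suc p mod n"
  by (simp add: next_wire_def mod_Suc_eq)

lemma prev_wire_mod: "0 < n \<Longrightarrow> prev_wire n (Suc p mod n) = p mod n"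
  by (metis next_wire_mod next_prev_wire(2) mod_less_divisor)

definition highway_step :: "nat \<Rightarrow> cycle_type list \<Rightarrow> arc \<Rightarrow> arc \<Rightarrow> bool" where
  "highway_step n cs e f \<longleftrightarrow> (\<exists>c \<in> crossings n cs.
     e \<in> {e1 n cs c, e2 n cs c} \<and> f \<in> {f1 n cs c, f2 n cs c} \<and> (e, f) \<noteq> (e2 n cs c, f2 n cs c))"

lemma steps_ok_Cons [simp]:
  "steps_ok n cs (e # f # p) \<longleftrightarrow> highway_step n cs e f \<and> steps_ok n cs (f # p)"
  by (simp add: steps_Cons highway_step_def)

lemma steps_ok_single [simp]: "steps_ok n cs [e]"
  by (simp add: steps_ok_def)

lemma zip_tl_snoc: "p \<noteq> [] \<Longrightarrow> zip (p @ [e]) (tl (p @ [e])) = zip p (tl p) @ [(last p, e)]"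
proof (induction p)
  case (Cons a p)
  then show ?case by (cases p) auto
qed simp

lemma steps_ok_iff: "steps_ok n cs p \<longleftrightarrow> (\<forall>(e, f) \<in> set (zip p (tl p)). highway_step n cs e f)"
  by (simp add: steps_ok_def highway_step_def)

lemma steps_ok_snoc:
  "p \<noteq> [] \<Longrightarrow> steps_ok n cs (p @ [e]) \<longleftrightarrow> steps_ok n cs p \<and> highway_step n cs (last p) e"
  unfolding steps_ok_iff by (subst zip_tl_snoc) auto

lemma prev_wire_eq_iff: "i < n \<Longrightarrow> j < n \<Longrightarrow> prev_wire n i = prev_wire n j \<longleftrightarrow> i = j"
  by (metis next_prev_wire(1))

text \<open>
  An edge starts at one crossing only. So the last edge of a walk determines the crossing at
  which the last step takes place, also for small \<open>n\<close>, where edges may be loops or parallel.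
\<close>
lemma outgoing_unique:
  assumes "c \<in> crossings n cs" "c' \<in> crossings n cs"
    and "f \<in> {f1 n cs c, f2 n cs c}" "f \<in> {f1 n cs c', f2 n cs c'}"
  shows "c = c'"
proof -
  obtain j k j' k' where c: "c = (j, k)" "c' = (j', k')" by (cases c, cases c') auto
  show ?thesis
    using assms unfolding c
    by (cases "kind cs k"; cases "kind cs k'"; auto simp: crossings_def prev_wire_eq_iff)
qed

lemma f1_neq_f2: "f1 n cs c \<noteq> f2 n cs c" and e1_neq_e2: "e1 n cs c \<noteq> e2 n cs c"
  by (cases c; cases "kind cs (snd c)"; simp)+

lemma highway_step_into_f1:
  assumes "c \<in> crossings n cs"
  shows "highway_step n cs e (f1 n cs c) \<longleftrightarrow> e \<in> {e1 n cs c, e2 n cs c}"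
  using assms f1_neq_f2 outgoing_unique unfolding highway_step_def by (metis insertCI prod.inject)

lemma highway_step_into_f2:
  assumes "c \<in> crossings n cs"
  shows "highway_step n cs e (f2 n cs c) \<longleftrightarrow> e = e1 n cs c"
  using assms f1_neq_f2 e1_neq_e2 outgoing_unique unfolding highway_step_def
  by (metis insertCI insertE empty_iff prod.inject)

lemma highway_step_not_source: "\<not> highway_step n cs e (Hor j 0)"
  by (auto simp: highway_step_def crossings_def split: cycle_type.splits)

lemma highway_paths_iff:
  "p \<in> highway_paths n cs u v \<longleftrightarrow>
     p \<noteq> [] \<and> hd p = Hor u 0 \<and> last p = Hor v (length cs) \<and> steps_ok n cs p"
proof
  assume "p \<in> highway_paths n cs u v"
  then show "p \<noteq> [] \<and> hd p = Hor u 0 \<and> last p = Hor v (length cs) \<and> steps_ok n cs p"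
    unfolding highway_paths_def directed_walk_def steps_ok_def by fastforce
next
  assume p: "p \<noteq> [] \<and> hd p = Hor u 0 \<and> last p = Hor v (length cs) \<and> steps_ok n cs p"
  then have st: "highway_step n cs e f" if "(e, f) \<in> set (zip p (tl p))" for e f
    using that by (auto simp: steps_ok_def highway_step_def)
  have "directed_walk n cs u v p"
    using p unfolding directed_walk_def steps_ok_def by blast
  moreover have "(e2 n cs c, f2 n cs c) \<notin> set (zip p (tl p))" if "c \<in> crossings n cs" for c
    using st[of "e2 n cs c" "f2 n cs c"] highway_step_into_f2[OF that] e1_neq_e2 by metis
  ultimately show "p \<in> highway_paths n cs u v"
    by (simp add: highway_paths_def)
qed


section \<open>Homology classes of highway paths\<close>

fun drop_of :: "cycle_type list \<Rightarrow> arc \<Rightarrow> int" where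
  "drop_of cs (Hor j k) = 0"
| "drop_of cs (Ver j k) = (case kind cs k of Whirl \<Rightarrow> - 1 | Curl \<Rightarrow> 1)"

text \<open>
  Downward minus upward edges: the displacement of the lifted path on the universal cover.
\<close>
definition total_drop :: "cycle_type list \<Rightarrow> arc list \<Rightarrow> int" where
  "total_drop cs p = (\<Sum>e\<leftarrow>p. drop_of cs e)"

lemma total_drop_counts:
  "total_drop cs p = int (length (filter (is_down cs) p)) - int (length (filter (is_up cs) p))"
proof (induction p)
  case (Cons e p)
  then show ?case by (cases e; cases "kind cs (acol e)") (auto simp: total_drop_def)
qed (simp add: total_drop_def)

fun arc_tail :: "nat \<Rightarrow> cycle_type list \<Rightarrow> arc \<Rightarrow> nat \<times> nat" where
  "arc_tail n cs (Hor j k) = (j, k)"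
| "arc_tail n cs (Ver j k) = (case kind cs k of Whirl \<Rightarrow> (next_wire n j, k) | Curl \<Rightarrow> (j, k))"

fun arc_head :: "nat \<Rightarrow> cycle_type list \<Rightarrow> arc \<Rightarrow> nat \<times> nat" where
  "arc_head n cs (Hor j k) = (j, Suc k)"
| "arc_head n cs (Ver j k) = (case kind cs k of Whirl \<Rightarrow> (j, k) | Curl \<Rightarrow> (next_wire n j, k))"

lemma highway_step_head_tail: "highway_step n cs e f \<Longrightarrow> arc_head n cs e = arc_tail n cs f"
proof -
  assume "highway_step n cs e f"
  then obtain c where c: "c \<in> crossings n cs" "e \<in> {e1 n cs c, e2 n cs c}" "f \<in> {f1 n cs c, f2 n cs c}"
    unfolding highway_step_def by blast
  obtain j k where jk: "c = (j, k)" by (cases c)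
  with c have "j < n" "0 < k" by (auto simp: crossings_def)
  with c jk
  have "arc_head n cs e = (j, k)" "arc_tail n cs f = (j, k)"
    by (cases "kind cs k"; elim insertE; simp)+
  then show ?thesis by simp
qed

text \<open>
  The boundary at the vertex \<open>(j, k)\<close> of a chain \<open>h\<close> with the orientations of the 1-cells, where
  \<open>k\<close> runs from the left boundary \<open>0\<close> to the right boundary \<open>m + 1\<close>.
\<close>
definition inflow :: "nat \<Rightarrow> nat \<Rightarrow> (arc \<Rightarrow> int) \<Rightarrow> nat \<Rightarrow> nat \<Rightarrow> int" where
  "inflow n m h j k = (if k = 0 then 0 else h (Hor j (k - 1))) + h (Ver (prev_wire n j) k)
     - (if k \<le> m then h (Hor j k) else 0) - h (Ver j k)"

lemma inflow_arc:
  assumes "e \<in> arcs n cs" "j < n"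
  shows "inflow n (length cs) (\<lambda>g. if e = g then (if is_up cs e then -1 else 1) else 0) j k =
     of_bool (arc_head n cs e = (j, k)) - of_bool (arc_tail n cs e = (j, k))"
proof (cases e)
  case (Hor i l)
  with assms show ?thesis by (auto simp: inflow_def arcs_def)
next
  case (Ver i l)
  with assms have i: "i < n" by (auto simp: arcs_def)
  show ?thesis
    using Ver next_wire_eq_iff[OF assms(2) i]
    by (cases "kind cs l"; cases "l = k") (auto simp: inflow_def)
qed

lemma inflow_path:
  assumes "steps_ok n cs p" "p \<noteq> []" "set p \<subseteq> arcs n cs" "j < n"
  shows "inflow n (length cs) (path_chain cs p) j k =
     of_bool (arc_head n cs (last p) = (j, k)) - of_bool (arc_tail n cs (hd p) = (j, k))"
  using assms(1-3)
proof (induction p)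
  case (Cons e p)
  have split: "inflow n (length cs) (path_chain cs (e # p)) j k = inflow n (length cs) (path_chain cs p) j k +
     inflow n (length cs) (\<lambda>g. if e = g then (if is_up cs e then -1 else 1) else 0) j k"
    unfolding inflow_def path_chain_Cons by simp
  also have "inflow n (length cs) (\<lambda>g. if e = g then (if is_up cs e then -1 else 1) else 0) j k =
      of_bool (arc_head n cs e = (j, k)) - of_bool (arc_tail n cs e = (j, k))"
    using Cons.prems assms(4) by (intro inflow_arc) auto
  finally have eq: "inflow n (length cs) (path_chain cs (e # p)) j k = inflow n (length cs) (path_chain cs p) j k +
      (of_bool (arc_head n cs e = (j, k)) - of_bool (arc_tail n cs e = (j, k)))" .
  show ?case
  proof (cases p)
    case Nil
    then show ?thesis using eq by (simp add: inflow_def)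
  next
    case p: (Cons f q)
    then have "arc_head n cs e = arc_tail n cs f"
      using Cons.prems by (intro highway_step_head_tail) simp
    then show ?thesis using eq p Cons by simp
  qed
qed simp

text \<open>
  A cycle whose vertical part adds up to zero is a boundary. The multiplicity of the face \<open>(j, k)\<close> is
  forced by the vertical arcs to its left, row by row. The horizontal arcs then fit because the chain
  is balanced at every vertex. That the last vertical arc fits means that each row of vertical arcs adds
  up to zero; by balance all rows have the same sum, and \<open>n\<close> times this sum is the total, zero.
\<close>
lemma null_homologous:
  fixes c :: "arc \<Rightarrow> int"
  assumes "\<And>j k. j < n \<Longrightarrow> inflow n (length cs) c j k = 0"
    and supp: "\<And>e. e \<notin> arcs n cs \<Longrightarrow> c e = 0"
    and net: "net n cs c = 0"
  shows "\<exists>d :: nat \<times> nat \<Rightarrow> int. \<forall>e. c e = (\<Sum>F \<in> {..<n} \<times> {..length cs}. d F * face_boundary n F e)"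
proof -
  let ?m = "length cs"
  let ?A = "{..<n} \<times> {..?m}"
  define T where "T j k = (\<Sum>k'\<le>k. c (Ver j k'))" for j k
  define d where "d F = - T (fst F) (snd F)" for F :: "nat \<times> nat"
  have flux: "(if k \<le> ?m then c (Hor j k) else 0) = T (prev_wire n j) k - T j k"
    if "j < n" "k \<le> Suc ?m" for j k
    using that(2)
  proof (induction k)
    case 0
    then show ?case using assms(1)[OF that(1), of 0] by (simp add: inflow_def T_def)
  next
    case (Suc k)
    then show ?case using assms(1)[OF that(1), of "Suc k"] by (simp add: inflow_def T_def split: if_splits)
  qed
  have step: "T (prev_wire n j) (Suc ?m) = T j (Suc ?m)" if "j < n" for j
    using flux[OF that, of "Suc ?m"] by simp
  have const: "T j (Suc ?m) = T 0 (Suc ?m)" if "j < n" for j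
    using that
  proof (induction j)
    case (Suc j)
    then show ?case using step[of "Suc j"] prev_wire_mod[of n j] by simp
  qed simp
  have "net n cs c = (\<Sum>j<n. T j (Suc ?m))"
    unfolding T_def by (rule sum.cartesian_product[symmetric])
  also have "\<dots> = int n * T 0 (Suc ?m)"
    by (subst sum.cong[OF refl const]) simp_all
  finally have total: "T j (Suc ?m) = 0" if "j < n" for j
    using net that by (simp add: const[OF that])
  have vtop: "c (Ver j k) = 0" if "?m < k" for j k
    using that by (intro supp) (auto simp: arcs_def)
  have delta: "(\<Sum>F\<in>?A. d F * of_bool (F = G)) = (if G \<in> ?A then d G else 0)" for G
  proof -
    have "(\<Sum>F\<in>?A. d F * of_bool (F = G)) = (\<Sum>F\<in>?A. if F = G then d F else 0)"
      by (rule sum.cong) auto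
    then show ?thesis by simp
  qed
  have "c e = (\<Sum>F\<in>?A. d F * face_boundary n F e)" for e
  proof (cases e)
    case (Hor i l)
    show ?thesis
    proof (cases "i < n \<and> l \<le> ?m")
      case True
      have "(\<Sum>F\<in>?A. d F * face_boundary n F e) =
          (\<Sum>F\<in>?A. d F * of_bool (F = (i, l)) - d F * of_bool (F = (prev_wire n i, l)))"
      proof (rule sum.cong)
        fix F assume "F \<in> ?A"
        then obtain a b where F: "F = (a, b)" "a < n" by auto
        have "Hor i l = Hor (next_wire n a) b \<longleftrightarrow> F = (prev_wire n i, l)"
          using next_wire_eq_iff[of i n a] True F by auto
        then show "d F * face_boundary n F e = d F * of_bool (F = (i, l)) - d F * of_bool (F = (prev_wire n i, l))"
          by (simp add: face_boundary_def F(1) Hor right_diff_distrib eq_commute)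
      qed simp
      also have "\<dots> = d (i, l) - d (prev_wire n i, l)"
        unfolding sum_subtractf delta using True by simp
      finally show ?thesis using flux[of i l] True by (simp add: d_def Hor)
    next
      case False
      then have "c e = 0" by (intro supp) (auto simp: Hor arcs_def)
      moreover have "(\<Sum>F\<in>?A. d F * face_boundary n F e) = 0"
        using False by (intro sum.neutral) (auto simp: Hor face_boundary_def)
      ultimately show ?thesis by simp
    qed
  next
    case (Ver i l)
    show ?thesis
    proof (cases "i < n \<and> l \<le> Suc ?m")
      case False
      then have "c e = 0" by (intro supp) (auto simp: Ver arcs_def)
      moreover have "(\<Sum>F\<in>?A. d F * face_boundary n F e) = 0"
        using False by (intro sum.neutral) (auto simp: Ver face_boundary_def)
      ultimately show ?thesis by simp
    next
      case True
      show ?thesis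
      proof (cases l)
        case 0
        have "(\<Sum>F\<in>?A. d F * face_boundary n F e) = (\<Sum>F\<in>?A. - (d F * of_bool (F = (i, l))))"
          by (intro sum.cong) (auto simp: face_boundary_def Ver 0)
        also have "\<dots> = - d (i, l)"
          unfolding sum_negf delta using True 0 by simp
        finally show ?thesis by (simp add: d_def Ver 0 T_def)
      next
        case (Suc l')
        have "(\<Sum>F\<in>?A. d F * face_boundary n F e) =
            (\<Sum>F\<in>?A. d F * of_bool (F = (i, l')) - d F * of_bool (F = (i, l)))"
          by (intro sum.cong) (auto simp: face_boundary_def Ver Suc)
        also have "\<dots> = d (i, l') - (if l \<le> ?m then d (i, l) else 0)"
          unfolding sum_subtractf delta using True Suc by simp
        also have "\<dots> = d (i, l') - d (i, l)"
          using True total[of i] by (auto simp: d_def le_Suc_eq)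
        finally show ?thesis by (simp add: d_def Ver Suc T_def)
      qed
    qed
  qed
  then show ?thesis by blast
qed

text \<open>
  Between given end points the displacement is the only invariant, so homology classes correspond to positions on the cover.
\<close>
lemma homologous_iff_total_drop:
  assumes "0 < n" "v < n" "p \<in> highway_paths n cs u v" "q \<in> highway_paths n cs u v"
  shows "homologous n cs p q \<longleftrightarrow> total_drop cs p = total_drop cs q"
proof -
  note arcs = highway_bounds(1)[OF assms(3,2)] highway_bounds(1)[OF assms(4,2)]
  have net_p: "net n cs (path_chain cs p) = total_drop cs p"
    and net_q: "net n cs (path_chain cs q) = total_drop cs q"
    unfolding total_drop_counts by (intro net_path arcs)+
  show ?thesis
  proof
    assume "homologous n cs p q"
    from homologous_net[OF this] show "total_drop cs p = total_drop cs q"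
      by (simp only: net_p net_q)
  next
    assume eq: "total_drop cs p = total_drop cs q"
    let ?c = "\<lambda>e. path_chain cs p e - path_chain cs q e"
    have "net n cs ?c = net n cs (path_chain cs p) - net n cs (path_chain cs q)"
      by (simp only: case_prod_unfold sum_subtractf)
    then have net: "net n cs ?c = 0" by (simp only: net_p net_q eq)
    have supp: "?c e = 0" if "e \<notin> arcs n cs" for e
    proof -
      have "e \<notin> set p" "e \<notin> set q" using that arcs by auto
      then show ?thesis by (cases e) (simp_all add: count_list_0_iff)
    qed
    have flow: "inflow n (length cs) ?c j k = 0" if "j < n" for j k
    proof -
      have "inflow n (length cs) ?c j k =
          inflow n (length cs) (path_chain cs p) j k - inflow n (length cs) (path_chain cs q) j k"
        by (simp add: inflow_def)
      also have "\<dots> = 0"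
        using assms(3,4) arcs that by (simp add: inflow_path highway_paths_iff)
      finally show ?thesis .
    qed
    show "homologous n cs p q"
      unfolding homologous_def by (rule null_homologous[OF flow supp net])
  qed
qed


section \<open>Flows as boundary measurements\<close>

text \<open>
  Highway walks from the source of wire \<open>u\<close> that end with the edge \<open>e\<close>, not necessarily at a sink,
  and have displacement \<open>t\<close>. Their weights are summed by recursion on the last step.
\<close>
definition walks_to :: "nat \<Rightarrow> cycle_type list \<Rightarrow> nat \<Rightarrow> arc \<Rightarrow> int \<Rightarrow> arc list set" where
  "walks_to n cs u e t = {p. p \<noteq> [] \<and> hd p = Hor u 0 \<and> last p = e \<and> steps_ok n cs p \<and> total_drop cs p = t}"

lemma total_drop_snoc: "total_drop cs (p @ [e]) = total_drop cs p + drop_of cs e"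
  by (simp add: total_drop_def)

lemma walks_to_snoc:
  "p \<noteq> [] \<Longrightarrow> p @ [e] \<in> walks_to n cs u f t \<longleftrightarrow>
     f = e \<and> highway_step n cs (last p) e \<and> p \<in> walks_to n cs u (last p) (t - drop_of cs e)"
  by (auto simp: walks_to_def steps_ok_snoc total_drop_snoc)

lemma walks_to_single: "[e] \<in> walks_to n cs u f t \<longleftrightarrow> f = e \<and> e = Hor u 0 \<and> t = 0"
  by (auto simp: walks_to_def total_drop_def)

lemma walks_to_endD: "p \<in> walks_to n cs u e t \<Longrightarrow> p \<noteq> [] \<and> last p = e"
  by (simp add: walks_to_def)

lemma walks_to_last_step:
  "walks_to n cs u e t = (if e = Hor u 0 \<and> t = 0 then {[e]} else {}) \<union>
     (\<Union>e' \<in> {e'. highway_step n cs e' e}. (\<lambda>p. p @ [e]) ` walks_to n cs u e' (t - drop_of cs e))"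
  (is "?L = ?R")
proof (rule Set.set_eqI)
  fix p
  show "p \<in> ?L \<longleftrightarrow> p \<in> ?R"
  proof (cases p rule: rev_cases)
    case Nil
    then show ?thesis by (auto simp: walks_to_def)
  next
    case (snoc q f)
    show ?thesis
    proof (cases "q = []")
      case True
      then show ?thesis by (auto simp: snoc walks_to_single dest: walks_to_endD)
    next
      case False
      then show ?thesis by (auto simp: snoc walks_to_snoc highway_step_not_source dest: walks_to_endD)
    qed
  qed
qed

text \<open>
  An upward edge can only be entered from a horizontal one, hence at most once per column.
\<close>
lemma total_drop_lower_bound:
  assumes "p \<in> walks_to n cs u e t"
  shows "0 \<le> t + int (acol e)"
  using assms
proof (induction p arbitrary: e t rule: rev_induct)
  case (snoc e' p)
  show ?case
  proof (cases "p = []")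
    case True
    with snoc.prems show ?thesis by (simp add: walks_to_single)
  next
    case False
    with snoc.prems have e: "e' = e" "highway_step n cs (last p) e"
      and p: "p \<in> walks_to n cs u (last p) (t - drop_of cs e)"
      by (auto simp: walks_to_snoc)
    from e(2) obtain c where c: "c \<in> crossings n cs" "last p \<in> {e1 n cs c, e2 n cs c}"
      "e \<in> {f1 n cs c, f2 n cs c}" "(last p, e) \<noteq> (e2 n cs c, f2 n cs c)"
      unfolding highway_step_def by blast
    obtain j k where jk: "c = (j, k)" by (cases c)
    with c(1) have "0 < k" by (simp add: crossings_def)
    with c(2-4) have "0 \<le> drop_of cs e + int (acol e) - int (acol (last p))"
      unfolding jk by (cases "kind cs k") auto
    with snoc.IH[OF p] show ?thesis by simp
  qed
qed (simp add: walks_to_def)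

definition step_weight ::
    "nat \<Rightarrow> cycle_type list \<Rightarrow> (nat \<Rightarrow> nat \<Rightarrow> complex) \<Rightarrow> arc \<Rightarrow> arc \<Rightarrow> complex" where
  "step_weight n cs x e f =
     (\<Prod>(j, k) \<in> crossings n cs. if (e, f) = (e1 n cs (j, k), f1 n cs (j, k)) then x k j else 1)"

lemma path_weight_single: "path_weight n cs [e] x = 1"
  by (simp add: path_weight_def)

lemma path_weight_snoc:
  assumes "p \<noteq> []"
  shows "path_weight n cs (p @ [e]) x = path_weight n cs p x * step_weight n cs x (last p) e"
  unfolding path_weight_def step_weight_def prod.distrib[symmetric] zip_tl_snoc[OF assms]
  by (rule prod.cong) auto

lemma step_weight_turn:
  assumes "\<And>c. c \<in> crossings n cs \<Longrightarrow> (e, f) \<noteq> (e1 n cs c, f1 n cs c)"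
  shows "step_weight n cs x e f = 1"
  unfolding step_weight_def by (rule prod.neutral) (use assms in \<open>fastforce simp del: e1.simps f1.simps\<close>)

lemma step_weight_straight:
  assumes "(j, k) \<in> crossings n cs"
  shows "step_weight n cs x (e1 n cs (j, k)) (f1 n cs (j, k)) = x k j"
proof -
  have "step_weight n cs x (e1 n cs (j, k)) (f1 n cs (j, k)) =
      (\<Prod>c \<in> crossings n cs. if c = (j, k) then x k j else 1)"
    unfolding step_weight_def
  proof (rule prod.cong)
    fix c assume c: "c \<in> crossings n cs"
    then show "(case c of (j', k') \<Rightarrow> if (e1 n cs (j, k), f1 n cs (j, k)) =
        (e1 n cs (j', k'), f1 n cs (j', k')) then x k' j' else 1) = (if c = (j, k) then x k j else 1)"
      using outgoing_unique[OF assms c, of "f1 n cs (j, k)"] by (cases c) (auto simp del: e1.simps f1.simps)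
  qed simp
  also have "\<dots> = x k j"
    using assms by (simp add: crossings_def)
  finally show ?thesis .
qed

text \<open>
  The sum is only meaningful for finitely many walks, so finiteness is carried through the recursion.
\<close>
definition walk_sum ::
    "nat \<Rightarrow> cycle_type list \<Rightarrow> nat \<Rightarrow> (nat \<Rightarrow> nat \<Rightarrow> complex) \<Rightarrow> arc \<Rightarrow> int \<Rightarrow> complex \<Rightarrow> bool" where
  "walk_sum n cs u x e t s \<longleftrightarrow>
     finite (walks_to n cs u e t) \<and> (\<Sum>p \<in> walks_to n cs u e t. path_weight n cs p x) = s"

lemma sum_extend_walks:
  assumes "walk_sum n cs u x e' t s"
  shows "finite ((\<lambda>p. p @ [e]) ` walks_to n cs u e' t)"
    and "(\<Sum>p \<in> (\<lambda>p. p @ [e]) ` walks_to n cs u e' t. path_weight n cs p x) = s * step_weight n cs x e' e"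
proof -
  show "finite ((\<lambda>p. p @ [e]) ` walks_to n cs u e' t)"
    using assms by (simp add: walk_sum_def)
  have "(\<Sum>p \<in> (\<lambda>p. p @ [e]) ` walks_to n cs u e' t. path_weight n cs p x) =
      (\<Sum>p \<in> walks_to n cs u e' t. path_weight n cs p x * step_weight n cs x e' e)"
    by (subst sum.reindex) (auto simp: inj_on_def walks_to_def path_weight_snoc intro!: sum.cong)
  then show "(\<Sum>p \<in> (\<lambda>p. p @ [e]) ` walks_to n cs u e' t. path_weight n cs p x) = s * step_weight n cs x e' e"
    using assms by (auto simp: walk_sum_def sum_distrib_right[symmetric])
qed

lemma walk_sum_f1:
  assumes c: "(j, k) \<in> crossings n cs"
    and s1: "walk_sum n cs u x (e1 n cs (j, k)) (t - drop_of cs (f1 n cs (j, k))) s1"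
    and s2: "walk_sum n cs u x (e2 n cs (j, k)) (t - drop_of cs (f1 n cs (j, k))) s2"
  shows "walk_sum n cs u x (f1 n cs (j, k)) t (x k j * s1 + s2)"
proof -
  let ?e1 = "e1 n cs (j, k)" and ?e2 = "e2 n cs (j, k)" and ?f = "f1 n cs (j, k)"
  let ?W = "\<lambda>e. (\<lambda>p. p @ [?f]) ` walks_to n cs u e (t - drop_of cs ?f)"
  have "?f \<noteq> Hor u 0"
    using highway_step_into_f1[OF c, of ?e1] highway_step_not_source by (metis insertI1)
  then have W: "walks_to n cs u ?f t = ?W ?e1 \<union> ?W ?e2"
    by (subst walks_to_last_step) (simp add: highway_step_into_f1[OF c] Collect_disj_eq Un_commute
        del: f1.simps e1.simps e2.simps)
  have disj: "?W ?e1 \<inter> ?W ?e2 = {}"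
    using e1_neq_e2[of n cs "(j, k)"] by (auto simp: walks_to_def simp del: f1.simps e1.simps e2.simps)
  have turn: "step_weight n cs x ?e2 ?f = 1"
  proof (rule step_weight_turn)
    fix c' assume c': "c' \<in> crossings n cs"
    show "(?e2, ?f) \<noteq> (e1 n cs c', f1 n cs c')"
      using outgoing_unique[OF c c', of ?f] e1_neq_e2[of n cs "(j, k)"]
      by (auto simp del: f1.simps e1.simps e2.simps)
  qed
  show ?thesis
    unfolding walk_sum_def W
    using sum_extend_walks[OF s1, of ?f] sum_extend_walks[OF s2, of ?f] disj
    by (simp add: sum.union_disjoint step_weight_straight[OF c] turn mult.commute
        del: f1.simps e1.simps e2.simps)
qed

lemma walk_sum_f2:
  assumes c: "c \<in> crossings n cs"
    and s: "walk_sum n cs u x (e1 n cs c) (t - drop_of cs (f2 n cs c)) s"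
  shows "walk_sum n cs u x (f2 n cs c) t s"
proof -
  let ?e1 = "e1 n cs c" and ?f = "f2 n cs c"
  have "?f \<noteq> Hor u 0"
    using highway_step_into_f2[OF c, of ?e1] highway_step_not_source by metis
  then have W: "walks_to n cs u ?f t = (\<lambda>p. p @ [?f]) ` walks_to n cs u ?e1 (t - drop_of cs ?f)"
    by (subst walks_to_last_step) (simp add: highway_step_into_f2[OF c])
  have turn: "step_weight n cs x ?e1 ?f = 1"
  proof (rule step_weight_turn)
    fix c' assume c': "c' \<in> crossings n cs"
    show "(?e1, ?f) \<noteq> (e1 n cs c', f1 n cs c')"
      using outgoing_unique[OF c c', of ?f] f1_neq_f2[of n cs c] by auto
  qed
  show ?thesis
    unfolding walk_sum_def W using sum_extend_walks[OF s, of ?f] by (simp add: turn)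
qed

text \<open>
  Induction on the columns, and inside a curl on the position: the walks that run down the curl are
  summed starting from position \<open>0\<close>, which no walk reaches.
\<close>
lemma walk_sum_flow:
  assumes n: "0 < n" and P: "length cs < P" and k: "k \<le> length cs"
  shows "walk_sum n cs (P mod n) x (Hor (p mod n) k) (int p - int P)
           (flow cs (\<lambda>k p. x k (p mod n)) P k p)"
  using k
proof (induction k arbitrary: p)
  case 0
  have "walks_to n cs (P mod n) (Hor (p mod n) 0) (int p - int P) = (if p = P then {[Hor (P mod n) 0]} else {})"
    by (subst walks_to_last_step) (auto simp: highway_step_not_source)
  then show ?case by (simp add: walk_sum_def path_weight_single)
next
  case (Suc k)
  let ?u = "P mod n" and ?f = "flow cs (\<lambda>k p. x k (p mod n)) P k"
  let ?X = "\<lambda>p. x (Suc k) (p mod n)"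
  have IH: "walk_sum n cs ?u x (Hor (p mod n) k) (int p - int P) (?f p)" for p
    using Suc by simp
  have c: "(p mod n, Suc k) \<in> crossings n cs" for p
    using n Suc.prems by (simp add: crossings_def)
  show ?case
  proof (cases "kind cs (Suc k)")
    case Whirl
    have up: "walk_sum n cs ?u x (Ver (p mod n) (Suc k)) (int p - int P) (?f (Suc p))"
      using walk_sum_f2[OF c[of "Suc p"], of ?u x "int p - int P"] IH[of "Suc p"] Whirl prev_wire_mod[OF n]
      by (simp add: algebra_simps)
    show ?thesis
      using walk_sum_f1[OF c[of p], of ?u x "int p - int P"] IH[of p] up Whirl by (simp add: whirl_op_def)
  next
    case Curl
    have down: "walk_sum n cs ?u x (Ver (prev_wire n (p mod n)) (Suc k)) (int p - int P) (curl_op ?X ?f p)" for p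
    proof (induction p)
      case 0
      have "walks_to n cs ?u (Ver (prev_wire n (0 mod n)) (Suc k)) (- int P) = {}"
        using total_drop_lower_bound[where t = "- int P"] P Suc.prems by fastforce
      then show ?case by (simp add: walk_sum_def)
    next
      case (Suc p)
      have "walk_sum n cs ?u x (Ver (p mod n) (Suc k)) (int (Suc p) - int P) (?X p * curl_op ?X ?f p + ?f p)"
        using walk_sum_f1[OF c[of p], of ?u x "int (Suc p) - int P"] Suc IH[of p] Curl by simp
      then show ?case by (simp add: prev_wire_mod[OF n] add.commute)
    qed
    show ?thesis
      using walk_sum_f2[OF c[of p], of ?u x "int p - int P"] down[of p] Curl by simp
  qed
qed

text \<open>
  The walks with a given displacement to a given sink form a homology class or, if there are none,
  contribute the constant zero.
\<close>
lemma flow_boundary_measurement: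
  assumes n: "0 < n" and P: "length cs < P"
  shows "(\<lambda>x. flow cs (\<lambda>k p. x k (p mod n)) P (length cs) p) \<in> polynomials_in (boundary_measurements n cs)"
proof -
  let ?u = "P mod n" and ?v = "p mod n"
  let ?K = "walks_to n cs ?u (Hor ?v (length cs)) (int p - int P)"
  have F: "(\<lambda>x. flow cs (\<lambda>k p. x k (p mod n)) P (length cs) p) = (\<lambda>x. \<Sum>q \<in> ?K. path_weight n cs q x)"
    using walk_sum_flow[OF assms order.refl] by (auto simp: walk_sum_def)
  have uv: "?u < n" "?v < n" using n by auto
  have K: "?K = {q \<in> highway_paths n cs ?u ?v. total_drop cs q = int p - int P}"
    by (auto simp: walks_to_def highway_paths_iff)
  show ?thesis
  proof (cases "?K = {}")
    case True
    show ?thesis unfolding F True by (simp add: polynomials_in.const)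
  next
    case False
    then obtain q where q: "q \<in> highway_paths n cs ?u ?v" "total_drop cs q = int p - int P"
      unfolding K by blast
    have "?K = homology_rel n cs ?u ?v `` {q}"
      using homologous_iff_total_drop[OF n uv(2) q(1)] q unfolding K homology_rel_def by auto
    then have "?K \<in> highway_paths n cs ?u ?v // homology_rel n cs ?u ?v"
      using q(1) by (auto simp: quotient_def)
    then have "(\<lambda>x. \<Sum>q \<in> ?K. path_weight n cs q x) \<in> boundary_measurements n cs"
      unfolding boundary_measurements_def using uv by blast
    then show ?thesis unfolding F by (rule polynomials_in.gen)
  qed
qed


section \<open>A weighting with nonsingular Hankel matrix\<close>

lemma flow_of_real:
  "flow cs (\<lambda>k p. of_real (X k p)) P k p = (of_real (flow cs X P k p) :: complex)"
proof (induction k arbitrary: p)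
  case (Suc k)
  have curl: "curl_op (\<lambda>p. of_real (Y p)) (\<lambda>p. of_real (f p)) p = (of_real (curl_op Y f p) :: complex)"
    for Y f :: "nat \<Rightarrow> real" and p
    by (induction p) auto
  from Suc have "flow cs (\<lambda>k p. of_real (X k p)) P k = (\<lambda>p. of_real (flow cs X P k p) :: complex)"
    by auto
  then show ?case by (auto simp: curl whirl_op_def split: cycle_type.split)
qed auto

text \<open>
  Solving \<open>g (p + 1) = f p + w g p\<close> for an exponential sum \<open>f\<close> gives a particular solution with the same
  bases plus a multiple of \<open>w ^ p\<close>. As \<open>g\<close> is nonnegative and not zero, it grows at least like
  \<open>w ^ p\<close>, while the particular solution is of smaller order; so the multiple is not zero.
\<close>
lemma curl_op_exponential_sum:
  fixes w :: real and f :: "nat \<Rightarrow> real"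
  assumes nonneg: "\<And>p. 0 \<le> f p" and pos: "0 < f q" and w: "0 < w"
    and fin: "finite L" and less: "\<And>l. l \<in> L \<Longrightarrow> \<bar>y l\<bar> < w"
    and f: "\<And>p. P < p \<Longrightarrow> f p = (\<Sum>l\<in>L. C l * y l ^ p)"
  obtains c where "c \<noteq> 0"
    and "\<And>p. P < p \<Longrightarrow> curl_op (\<lambda>_. w) f p = c * w ^ p + (\<Sum>l\<in>L. C l / (y l - w) * y l ^ p)"
proof -
  let ?g = "curl_op (\<lambda>_. w) f"
  \<comment> \<open>The particular solution.\<close>
  define S where "S p = (\<Sum>l\<in>L. C l / (y l - w) * y l ^ p)" for p
  have S_Suc: "S (Suc p) = f p + w * S p" if "P < p" for p
  proof -
    have "C l / (y l - w) * y l ^ Suc p = C l * y l ^ p + w * (C l / (y l - w) * y l ^ p)" if "l \<in> L" for l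
      using less[OF that] by (simp add: field_simps)
    then show ?thesis using that by (simp add: S_def f sum.distrib sum_distrib_left)
  qed
  define c where "c = (?g (Suc P) - S (Suc P)) / w ^ Suc P"
  have g: "?g p = c * w ^ p + S p" if "P < p" for p
    using that[THEN Suc_leI]
  proof (induction p rule: dec_induct)
    case base
    show ?case using w by (simp add: c_def)
  next
    case (step p)
    then show ?case using S_Suc[of p] by (simp add: algebra_simps)
  qed
  have g_nonneg: "0 \<le> ?g p" for p
    by (induction p) (use nonneg w in auto)
  have growth: "?g (Suc q) * w ^ t \<le> ?g (Suc q + t)" for t
  proof (induction t)
    case (Suc t)
    have "?g (Suc q) * w ^ Suc t \<le> w * ?g (Suc q + t)"
      using mult_left_mono[OF Suc] w by (simp add: algebra_simps)
    also have "\<dots> \<le> ?g (Suc q + Suc t)" using nonneg by simp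
    finally show ?case .
  qed simp
  have "c \<noteq> 0"
  proof
    assume "c = 0"
    \<comment> \<open>Now the solution is the particular one, which is too small for the growth by \<open>w\<close>.\<close>
    have "(\<lambda>p. \<Sum>l\<in>L. C l / (y l - w) * (y l / w) ^ p) \<longlonglongrightarrow> (\<Sum>l\<in>L. C l / (y l - w) * 0)"
    proof (intro tendsto_sum tendsto_mult tendsto_const)
      fix l assume "l \<in> L"
      then have "norm (y l / w) < 1" using less[of l] w by simp
      then show "(\<lambda>p. (y l / w) ^ p) \<longlonglongrightarrow> 0" by (rule LIMSEQ_power_zero)
    qed
    then have lim: "(\<lambda>p. S p / w ^ p) \<longlonglongrightarrow> 0"
      by (simp add: S_def sum_divide_distrib power_divide)
    have "?g (Suc q) / w ^ Suc q \<le> S p / w ^ p" if p: "P < p" "Suc q \<le> p" for p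
    proof -
      obtain t where t: "p = Suc q + t" using p(2) le_Suc_ex by blast
      have "?g (Suc q) * w ^ t / w ^ p \<le> S p / w ^ p"
        using growth[of t] g[OF p(1)] \<open>c = 0\<close> w unfolding t[symmetric]
        by (intro divide_right_mono) auto
      then show ?thesis using w by (simp add: t power_add)
    qed
    then have "?g (Suc q) / w ^ Suc q \<le> 0"
      by (intro LIMSEQ_le_const[OF lim]) (auto intro!: exI[of _ "Suc (P + q)"])
    moreover have "0 < ?g (Suc q)"
      using pos g_nonneg[of q] w by (simp add: add_pos_nonneg)
    then have "0 < ?g (Suc q) / w ^ Suc q"
      using w by (intro divide_pos_pos zero_less_power)
    ultimately show False by linarith
  qed
  with g show thesis using that by (simp add: S_def)
qed

text \<open>
  The weights increase from left to right, so that each curl has a larger weight than all earlier ones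
  and contributes a new dominant exponential.
\<close>
lemma flow_homogeneous:
  defines "F \<equiv> \<lambda>cs P k. flow cs (\<lambda>k p. real k) P k"
  shows "(\<forall>p. 0 \<le> F cs P k p) \<and> (\<exists>q. 0 < F cs P k q) \<and>
    (\<exists>C. (\<forall>l \<in> curl_columns cs k. C l \<noteq> 0) \<and>
       (\<forall>p>P. F cs P k p = (\<Sum>l \<in> curl_columns cs k. C l * real l ^ p)))"
proof (induction k)
  case 0
  show ?case by (auto simp: F_def)
next
  case (Suc k)
  then obtain q C where nonneg: "\<And>p. 0 \<le> F cs P k p" and pos: "0 < F cs P k q"
    and C: "\<And>l. l \<in> curl_columns cs k \<Longrightarrow> C l \<noteq> 0"
    and F: "\<And>p. P < p \<Longrightarrow> F cs P k p = (\<Sum>l \<in> curl_columns cs k. C l * real l ^ p)"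
    by blast
  let ?w = "real (Suc k)"
  show ?case
  proof (cases "kind cs (Suc k)")
    case Whirl
    have F_Suc: "F cs P (Suc k) p = ?w * F cs P k p + F cs P k (Suc p)" for p
      using Whirl by (simp add: F_def whirl_op_def)
    have "F cs P (Suc k) p = (\<Sum>l \<in> curl_columns cs (Suc k). C l * (?w + real l) * real l ^ p)" if "P < p" for p
      using that Whirl unfolding F_Suc by (simp add: F curl_columns_Suc sum_distrib_left sum.distrib[symmetric] algebra_simps)
    moreover have "C l * (?w + real l) \<noteq> 0" if "l \<in> curl_columns cs (Suc k)" for l
      using C that Whirl by (auto simp: curl_columns_Suc)
    moreover have "0 < F cs P (Suc k) q" "0 \<le> F cs P (Suc k) p" for p
      unfolding F_Suc using nonneg pos by (auto intro!: add_pos_nonneg add_nonneg_nonneg mult_pos_pos mult_nonneg_nonneg)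
    ultimately show ?thesis
      by (intro conjI exI[of _ "\<lambda>l. C l * (?w + real l)"] exI[of _ q]) auto
  next
    case Curl
    have F_Suc: "F cs P (Suc k) = curl_op (\<lambda>_. ?w) (F cs P k)"
      using Curl by (simp add: F_def)
    have nonneg': "0 \<le> F cs P (Suc k) p" for p
      unfolding F_Suc by (induction p) (use nonneg in auto)
    have "\<bar>real l\<bar> < ?w" if "l \<in> curl_columns cs k" for l
      using that by (simp add: curl_columns_def)
    then obtain c where c: "c \<noteq> 0"
      and g: "\<And>p. P < p \<Longrightarrow> F cs P (Suc k) p =
        c * ?w ^ p + (\<Sum>l\<in>curl_columns cs k. C l / (real l - ?w) * real l ^ p)"
      using curl_op_exponential_sum[of "F cs P k" q ?w "curl_columns cs k" real P C] nonneg pos F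
      unfolding F_Suc by auto
    let ?C = "\<lambda>l. if l = Suc k then c else C l / (real l - ?w)"
    have C': "?C l \<noteq> 0" if "l \<in> curl_columns cs (Suc k)" for l
      using that c C Curl by (auto simp: curl_columns_Suc curl_columns_def)
    have "F cs P (Suc k) p = (\<Sum>l \<in> curl_columns cs (Suc k). ?C l * real l ^ p)" if "P < p" for p
    proof -
      have "(\<Sum>l\<in>curl_columns cs k. C l / (real l - ?w) * real l ^ p) =
          (\<Sum>l\<in>curl_columns cs k. ?C l * real l ^ p)"
        by (rule sum.cong) (auto simp: curl_columns_def)
      then show ?thesis using g[OF that] Curl by (simp add: curl_columns_Suc)
    qed
    moreover have "0 < F cs P (Suc k) (Suc q)"
      using pos nonneg'[of q] unfolding F_Suc by (simp add: add_pos_nonneg)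
    ultimately show ?thesis
      using nonneg' C' by (intro conjI exI[of _ ?C] exI[of _ "Suc q"]) auto
  qed
qed

lemma flow_hankel_nonzero:
  assumes N: "0 < N" and Q: "P < Q"
  shows "det (mat (card (curl_columns cs k)) (card (curl_columns cs k))
    (\<lambda>(i, j). flow cs (\<lambda>k p. of_nat k :: complex) P k (Q + N * (i + j)))) \<noteq> 0"
proof -
  let ?L = "curl_columns cs k"
  obtain C where C: "\<And>l. l \<in> ?L \<Longrightarrow> C l \<noteq> 0"
    and F: "\<And>p. P < p \<Longrightarrow> flow cs (\<lambda>k p. real k) P k p = (\<Sum>l \<in> ?L. C l * real l ^ p)"
    using flow_homogeneous[of cs P k] by blast
  show ?thesis
  proof (rule hankel_det_nonzero)
    show "of_real (C l * real l ^ Q) \<noteq> (0::complex)" if "l \<in> ?L" for l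
      using C[OF that] that by (auto simp: curl_columns_def)
    show "inj_on (\<lambda>l. of_nat l ^ N :: complex) ?L"
    proof (rule inj_onI)
      fix l l' assume "of_nat l ^ N = (of_nat l' ^ N :: complex)"
      then have "l ^ N = l' ^ N" by (simp flip: of_nat_power)
      then show "l = l'" using N by (simp add: power_eq_iff_eq_base)
    qed
    show "flow cs (\<lambda>k p. of_nat k :: complex) P k (Q + N * i) =
        (\<Sum>l\<in>?L. of_real (C l * real l ^ Q) * (of_nat l ^ N) ^ i)" for i
    proof -
      have "flow cs (\<lambda>k p. of_nat k) P k (Q + N * i) =
          (of_real (flow cs (\<lambda>k p. real k) P k (Q + N * i)) :: complex)"
        using flow_of_real[of cs "\<lambda>k p. real k"] by simp
      then show ?thesis using Q by (simp add: F power_add power_mult mult_ac)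
    qed
  qed simp
qed


section \<open>The crystal functions as ratios of bordered determinants\<close>

theorem proposition11p10:
  fixes n a b j :: nat and cs :: "cycle_type list"
  assumes "count_list cs Whirl = b" and "count_list cs Curl = a"
    and "j < n"
  shows "rational_in (weightings n cs) (boundary_measurements n cs) (crystal_epsilon n cs j) \<and>
    rational_in (weightings n cs) (boundary_measurements n cs) (crystal_phi n cs j)"
proof (cases "cs = []")
  case True
  have "rational_in (weightings n cs) (boundary_measurements n cs) (\<lambda>_. 0)"
    unfolding rational_in_def
    by (intro bexI[of _ "\<lambda>_. 0"] bexI[of _ "\<lambda>_. 1"] conjI bexI[of _ "\<lambda>_ _. 1"])
      (auto simp: weightings_def intro: polynomials_in.const)
  moreover have "crystal_epsilon n cs j = (\<lambda>_. 0)" "crystal_phi n cs j = (\<lambda>_. 0)"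
    by (auto simp: True crystal_epsilon_def crystal_phi_def crystal_denom_def)
  ultimately show ?thesis by simp
next
  case False
  let ?S = "boundary_measurements n cs" and ?m = "length cs"
  define N where "N = 2 * n"
  \<comment> \<open>A lift of the wire \<open>j\<close>, far enough from position \<open>0\<close>.\<close>
  define P where "P = j + n * Suc ?m"
  define d where "d = card (curl_columns cs ?m)"
  define X where "X x k p = x k (p mod n)" for x :: "nat \<Rightarrow> nat \<Rightarrow> complex" and k p
  have n: "0 < n" and N: "2 \<le> N" "0 < N" using assms(3) by (auto simp: N_def)
  have "Suc ?m \<le> n * Suc ?m" using n by (metis mult_le_mono1 nat_mult_1 Suc_leI One_nat_def)
  then have P: "?m < P" by (simp add: P_def)
  have "P mod n = j" using assms(3) by (simp add: P_def del: mult_Suc_right)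
  then have wire: "P mod n = j" "Suc P mod n = next_wire n j"
    using next_wire_mod[of n P] by simp_all
  have per: "periodic N (X x k)" for x k
    by (simp add: periodic_def X_def N_def)
  define r where "r x = recurrence_poly cs N (X x) ?m" for x
  \<comment> \<open>The first \<open>d\<close> rows are equations for the coefficients of the recurrence; they use positions
    beyond the source \<open>P + 1\<close>. The last row applies the recurrence at \<open>p\<close> to the flow from \<open>Q\<close>.\<close>
  define c where "c Q p x i l = (if i < d then flow cs (X x) (Suc P) ?m (P + 2 + N * (i + l))
    else flow cs (X x) Q ?m (p + N * l))" for Q p x i l
  define \<Delta> where "\<Delta> Q p x = det (mat (Suc d) (Suc d) (\<lambda>(i, l). c Q p x i l))" for Q p x
  define H where "H x = det (mat d d (\<lambda>(i, l). flow cs (X x) (Suc P) ?m (P + 2 + N * (i + l))))" for x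
  have \<Delta>_poly: "\<Delta> Q p \<in> polynomials_in ?S" if "?m < Q" for Q p
    unfolding \<Delta>_def
  proof (rule polynomials_in_det)
    fix i l
    have "X = (\<lambda>x k p. x k (p mod n))" by (simp add: X_def fun_eq_iff)
    then show "(\<lambda>x. c Q p x i l) \<in> polynomials_in ?S"
      using flow_boundary_measurement[OF n that] flow_boundary_measurement[OF n, of cs "Suc P"] P
      by (cases "i < d") (simp_all add: c_def)
  qed
  have recurrence: "(\<Sum>l\<le>d. flow cs (X x) Q ?m (p + N * l) * coeff (r x) l) = cleared_flow cs N (X x) Q ?m p"
    for Q p x
  proof -
    have "degree (r x) = d" by (simp add: r_def d_def degree_recurrence_poly)
    then have "(\<Sum>l\<le>d. flow cs (X x) Q ?m (p + N * l) * coeff (r x) l) =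
        shift_poly N (r x) (flow cs (X x) Q ?m) p"
      by (simp add: shift_poly_def mult.commute)
    then show ?thesis by (simp add: r_def shift_poly_flow[OF per])
  qed
  have \<Delta>: "\<Delta> Q p x = H x * cleared_flow cs N (X x) Q ?m p" for Q p x
  proof -
    have "\<Delta> Q p x = det (mat d d (\<lambda>(i, l). c Q p x i l)) * (\<Sum>l\<le>d. c Q p x d l * coeff (r x) l)"
      unfolding \<Delta>_def
    proof (rule det_bordered)
      show "(\<Sum>l\<le>d. c Q p x i l * coeff (r x) l) = 0" if "i < d" for i
        using recurrence[of x "Suc P" "P + 2 + N * i"] that
        by (simp add: c_def cleared_flow_above algebra_simps)
      show "coeff (r x) d = 1"
        using lead_coeff_recurrence_poly[of cs N "X x" ?m] by (simp add: r_def d_def degree_recurrence_poly)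
    qed
    moreover have "mat d d (\<lambda>(i, l). c Q p x i l) =
        mat d d (\<lambda>(i, l). flow cs (X x) (Suc P) ?m (P + 2 + N * (i + l)))"
      by (rule eq_matI) (auto simp: c_def)
    ultimately show ?thesis using recurrence[of x Q p] by (simp add: H_def c_def)
  qed
  define \<kappa> where "\<kappa> x = (\<Prod>k = 1..?m. curl_factor cs N (X x) P k)" for x
  have z: "zflow cs (X x) P k = zpar n cs j x k" and t: "tflow cs (X x) P k = tpar n cs j x k" for x k
    by (simp_all add: zflow_def zpar_def tflow_def tpar_def X_def wire split: cycle_type.split)
  have \<Delta>_z: "\<Delta> P P x = H x * \<kappa> x * (\<Prod>k = 1..?m. zpar n cs j x k)" for x
    by (simp add: \<Delta> cleared_flow_top[OF N(1)] prod.distrib \<kappa>_def z)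
  have \<Delta>_t: "\<Delta> (Suc P) (Suc P) x = H x * \<kappa> x * (\<Prod>k = 1..?m. tpar n cs j x k)" for x
    by (simp add: \<Delta> cleared_flow_Suc_top[OF N(1) per] prod.distrib \<kappa>_def t)
  have \<Delta>_denom: "\<Delta> (Suc P) P x = H x * \<kappa> x * crystal_denom n cs j x" for x
    by (simp add: \<Delta> cleared_flow_Suc_below_top[OF N(1) per] \<kappa>_def z t crystal_denom_def)
  \<comment> \<open>Positive weights that increase from column to column make the Hankel determinant nonzero, and positivity
    makes the denominator nonzero.\<close>
  define x0 :: "nat \<Rightarrow> nat \<Rightarrow> complex" where "x0 k j = of_nat k" for k j
  have x0: "x0 \<in> weightings n cs"
    by (auto simp: weightings_def crossings_def x0_def)
  have "X x0 = (\<lambda>k p. of_nat k)"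
    by (simp add: X_def x0_def fun_eq_iff)
  then have "H x0 \<noteq> 0"
    using flow_hankel_nonzero[OF N(2), of "Suc P" "P + 2" cs ?m]
    by (simp add: H_def d_def)
  moreover have "\<kappa> x0 \<noteq> 0"
    by (auto simp: \<kappa>_def curl_factor_def X_def x0_def prod_zero_iff split: cycle_type.splits)
  moreover have "crystal_denom n cs j x0 \<noteq> 0"
  proof -
    have "zpar n cs j x0 k = of_nat k" "tpar n cs j x0 k = of_nat k" for k
      by (simp_all add: zpar_def tpar_def x0_def split: cycle_type.split)
    then have "crystal_denom n cs j x0 =
        of_nat (\<Sum>s<?m. (\<Prod>k = 1..s. k) * (\<Prod>k = s + 2..?m. k))"
      by (simp add: crystal_denom_def)
    moreover have "(0::nat) < (\<Sum>s<?m. (\<Prod>k = 1..s. k) * (\<Prod>k = s + 2..?m. k))"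
      using False by (intro sum_pos) auto
    ultimately show ?thesis by (metis of_nat_eq_0_iff less_irrefl)
  qed
  ultimately have nz: "\<Delta> (Suc P) P x0 \<noteq> 0"
    by (simp add: \<Delta>_denom)
  have quotient: "rational_in (weightings n cs) ?S (\<lambda>x. g x / crystal_denom n cs j x)"
    if "?m < Q" "\<And>x. \<Delta> Q p x = H x * \<kappa> x * g x" for g Q p
  proof -
    have "g x / crystal_denom n cs j x = \<Delta> Q p x / \<Delta> (Suc P) P x" if "\<Delta> (Suc P) P x \<noteq> 0" for x
      using that \<open>\<And>x. \<Delta> Q p x = H x * \<kappa> x * g x\<close> by (simp add: \<Delta>_denom)
    moreover have "\<Delta> Q p \<in> polynomials_in ?S" "\<Delta> (Suc P) P \<in> polynomials_in ?S"
      using \<Delta>_poly that(1) P by auto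
    ultimately show ?thesis
      unfolding rational_in_def using nz x0 by blast
  qed
  have "rational_in (weightings n cs) ?S (crystal_epsilon n cs j)"
    unfolding crystal_epsilon_def using P by (intro quotient[OF _ \<Delta>_t]) simp
  moreover have "rational_in (weightings n cs) ?S (crystal_phi n cs j)"
    unfolding crystal_phi_def by (intro quotient[OF P \<Delta>_z])
  ultimately show ?thesis ..
qed

end
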